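(* Let $\mathcal{A}=\{A_i\}_{i\in \mathcal{I}}$ be a finite set of invertible $d\times d$ real matrices such that $\|A_i\|<1/2$ for all $i\in \mathcal{I}$ and $\lambda(\mathcal{A})>1$. Then the following statements are true. 1. Let $(i_{n,m})_{(n,m)\in \mathbb{N}\times \mathbb{N}}\in \mathcal{I}^{\mathbb{N}\times \mathbb{N}}$ and let $(E_n)_{n\ge1}$ be a sequence of Borel subsets of $\mathbb{R}^d$ satisfying: (a) there exists $Q>0$ such that $E_n\subset [-Q,Q]^d$ for all $n$; (b) $\mathcal{L}_{d}(E_n)=\lambda(\mathcal{A})^{-n}$ for all $n$; (c) $s\cdot E_n\subset E_n$ for all $s\in(0,1)$ and all $n$; (d) there exists $C>0$ such that for each $n$ there exists $r_n>0$ with $\mathcal{L}_{d}([-r_n,r_n]^d+E_n)\leq C\mathcal{L}_{d}(E_n)$ and $\mathcal{L}_{d}([-r_n,r_n]^d-E_n)\leq C\mathcal{L}_{d}(E_n)$. Then for Lebesgue almost every $\mathbf{t}\in \mathbb{R}^{\#\mathcal{I}\cdot d}$, $$\limsup_{n\to\infty}\mathcal{L}_{d}\left(\left\{x\in\mathbb{R}^d:\exists (i_1,\ldots,i_n)\in \mathcal{I}^n \text{ such that } (T_{i_n,\mathbf{t}}\circ \cdots \circ T_{i_1,\mathbf{t}})(x)\in \pi_{\mathbf{t}}((i_{n,m})_{m=1}^{\infty})+E_n\right\}\right)>0.$$ Moreover, for Lebesgue almost every $\mathbf{t}\in \mathbb{R}^{\#\mathcal{I}\cdot d}$, the set $W\left(\mathcal{S}_{\mathbf{t}},(\pi_{\mathbf{t}}((i_{n,m})_{m=1}^{\infty}))_{n=1}^{\infty},(E_n)\right)$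 has positive Lebesgue measure. 2. Let $\mathbf{i}\in \mathcal{I}^{\mathbb{N}}$ and assume that $X_{\mathbf{t}}$ is differentiation regular for Lebesgue almost every $\mathbf{t}\in \mathbb{R}^{\#\mathcal{I}\cdot d}$. Then for Lebesgue almost every $\mathbf{t}\in \mathbb{R}^{\#\mathcal{I}\cdot d}$, Lebesgue almost every $x\in X_{\mathbf{t}}$ is contained in the set $\bigcup_{C>0}W(\mathcal{S}_{\mathbf{t}},\pi_{\mathbf{t}}(\mathbf{i}),C)$. 3. Let $(E_n)_{n\ge1}$ be a sequence of Borel subsets of $\mathbb{R}^d$ satisfying (a), (b), (c) and (d) of part 1. Then for Lebesgue almost every $\mathbf{t}\in \mathbb{R}^{\#\mathcal{I}\cdot d}$, $$\limsup_{n\to\infty}\mathcal{L}_{d}\left(\left\{x\in\mathbb{R}^d:\exists (i_1,\ldots,i_n)\in \mathcal{I}^n \text{ such that } (T_{i_n,\mathbf{t}}\circ \cdots \circ T_{i_1,\mathbf{t}})(x)\in x+E_n\right\}\right)>0.$$ Moreover, for Lebesgue almost every $\mathbf{t}\in \mathbb{R}^{\#\mathcal{I}\cdot d}$, the set $R(\mathcal{S}_{\mathbf{t}},(E_n))$ has positive Lebesgue measure.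
   Context: $\mathcal{L}_d$ is Lebesgue measure on $\mathbb{R}^d$; $\|\cdot\|$ is the operator norm for the Euclidean norm; $B(x,r)$ is the closed Euclidean ball with centre $x$ and radius $r$; $F\pm E=\{f\pm e:f\in F,e\in E\}$ and $s\cdot E=\{se:e\in E\}$. For a finite set of invertible $d\times d$ matrices $\mathcal{A}=\{A_i\}_{i\in\mathcal{I}}$ with $\|A_i\|<1$, let $\lambda(\mathcal{A})=\sum_{i\in\mathcal{I}}|\det(A_i)|$. For $\mathbf{t}=(t_i)_{i\in\mathcal{I}}\in(\mathbb{R}^d)^{\mathcal{I}}\cong\mathbb{R}^{\#\mathcal{I}\cdot d}$ let $\mathcal{S}_{\mathbf{t}}=\{S_{i,\mathbf{t}}\}_{i\in\mathcal{I}}$ with $S_{i,\mathbf{t}}(x)=A_ix+t_i$, let $T_{i,\mathbf{t}}=S_{i,\mathbf{t}}^{-1}$, and let $X_{\mathbf{t}}$ be the self-affine set, i.e. the unique non-empty compact set with $X_{\mathbf{t}}=\bigcup_{i\in\mathcal{I}}S_{i,\mathbf{t}}(X_{\mathbf{t}})$. The projection $\pi_{\mathbf{t}}:\mathcal{I}^{\mathbb{N}}\to X_{\mathbf{t}}$ is $\pi_{\mathbf{t}}((i_n)_{n\ge1})=\lim_{n\to\infty}(S_{i_1,\mathbf{t}}\circ\cdots\circ S_{i_n,\mathbf{t}})(0)$. For $\mathbf{x}=(x_n)\in X_{\mathbf{t}}^{\mathbb{N}}$ and Borel sets $(E_n)$, $W(\mathcal{S}_{\mathbf{t}},\mathbf{x},(E_n))$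 is the set of $x\in X_{\mathbf{t}}$ such that $(T_{i_N,\mathbf{t}}\circ\cdots\circ T_{i_1,\mathbf{t}})(x)\in x_N+E_N$ for infinitely many words $(i_1,\ldots,i_N)\in\bigcup_{n\ge1}\mathcal{I}^n$. $R(\mathcal{S}_{\mathbf{t}},(E_n))$ is the set of $x\in X_{\mathbf{t}}$ such that $(T_{i_N,\mathbf{t}}\circ\cdots\circ T_{i_1,\mathbf{t}})(x)\in x+E_N$ for infinitely many words $(i_1,\ldots,i_N)\in\bigcup_{n\ge1}\mathcal{I}^n$. For $y\in X_{\mathbf{t}}$ and $C>0$, $W(\mathcal{S}_{\mathbf{t}},y,C)$ is the set of $x\in X_{\mathbf{t}}$ such that $(T_{i_N,\mathbf{t}}\circ\cdots\circ T_{i_1,\mathbf{t}})(x)\in B\left(y,(C/\lambda(\mathcal{A})^N)^{1/d}\right)$ for infinitely many words $(i_1,\ldots,i_N)\in\bigcup_{n\ge1}\mathcal{I}^n$. A family $\mathcal{V}$ of open sets is a density basis for a Borel set $X\subset\mathbb{R}^d$ if: for all $x\in X$ there are arbitrarily small $V\in\mathcal{V}$ containing $x$; and for any Borel set $A\subset X$, $\lim_{V\to x,\,x\in V\in\mathcal{V}}\frac{\mathcal{L}_d(V\cap A)}{\mathcal{L}_d(V)}=\chi_A(x)$ for Lebesgue almost every $x\in\mathbb{R}^d$, where $V\to x$ means $\mathrm{diam}(V\cup\{x\})\to0$. Let $X$ be the self-affine set of an iterated function system $\{S_i\}_{i\in\mathcal{I}}$ with $\mathcal{L}_d(X)>0$.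 $X$ is differentiation regular if there exist a density basis $\mathcal{V}$ for $X$ and a constant $\eta>0$ such that for every $x\in X$ there is a sequence $\{V_j(x)\}$ in $\mathcal{V}$ with: $x\in V_j(x)$ for all $j$; $V_j(x)\to x$ as $j\to\infty$; and for each $V_j(x)$ there is a word $(i_1,\ldots,i_n)$ with $(S_{i_1}\circ\cdots\circ S_{i_n})(X)\subset V_j(x)$ and $\mathcal{L}_d((S_{i_1}\circ\cdots\circ S_{i_n})(X))\ge\eta\,\mathcal{L}_d(V_j(x))$. *)

theory Defs
  imports "HOL-Analysis.Analysis"
begin

text \<open>
  Sequences indexed by the positive integers are functions on \<^typ>\<open>nat\<close> whose value at 0 is never
  used; finite words are lists, and the infinite word \<open>\<omega>\<close> has the letters \<open>\<omega> 1, \<omega> 2, \<dots>\<close>.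
  The index set of an iterated function system is a finite type \<open>'i\<close>.
\<close>

definition mink_sum :: "'a::ab_group_add set \<Rightarrow> 'a set \<Rightarrow> 'a set" where
  "mink_sum F E = {f + e | f e. f \<in> F \<and> e \<in> E}"

definition mink_diff :: "'a::ab_group_add set \<Rightarrow> 'a set \<Rightarrow> 'a set" where
  "mink_diff F E = {f - e | f e. f \<in> F \<and> e \<in> E}"

definition cube :: "real \<Rightarrow> (real ^ 'd) set" where
  "cube r = cbox (\<chi> j. - r) (\<chi> j. r)"

definition lam :: "('i::finite \<Rightarrow> real ^ 'd ^ 'd) \<Rightarrow> real" where
  "lam A = (\<Sum>i\<in>UNIV. \<bar>det (A i)\<bar>)"

definition ifs :: "('i::finite \<Rightarrow> real ^ 'd ^ 'd) \<Rightarrow> (real ^ 'd) ^ 'i \<Rightarrow> 'i \<Rightarrow> real ^ 'd \<Rightarrow> real ^ 'd" where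
  "ifs A t i x = A i *v x + t $ i"

text \<open>\<open>S_word S [i\<^sub>1, \<dots>, i\<^sub>n]\<close> is \<open>S\<^sub>i\<^sub>1 \<circ> \<dots> \<circ> S\<^sub>i\<^sub>n\<close>, whereas \<open>T_word S [i\<^sub>1, \<dots>, i\<^sub>n]\<close> is
  \<open>T\<^sub>i\<^sub>n \<circ> \<dots> \<circ> T\<^sub>i\<^sub>1\<close> with \<open>T\<^sub>i\<close> the inverse of \<open>S\<^sub>i\<close>.\<close>

definition S_word :: "('i \<Rightarrow> 'a \<Rightarrow> 'a) \<Rightarrow> 'i list \<Rightarrow> 'a \<Rightarrow> 'a" where
  "S_word S w x = foldr S w x"

definition T_word :: "('i \<Rightarrow> 'a \<Rightarrow> 'a) \<Rightarrow> 'i list \<Rightarrow> 'a \<Rightarrow> 'a" where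
  "T_word S w x = fold (\<lambda>i. inv (S i)) w x"

definition attractor :: "('i \<Rightarrow> 'a::topological_space \<Rightarrow> 'a) \<Rightarrow> 'a set" where
  "attractor S = (THE X. X \<noteq> {} \<and> compact X \<and> X = (\<Union>i. S i ` X))"

definition proj :: "('i \<Rightarrow> real ^ 'd \<Rightarrow> real ^ 'd) \<Rightarrow> (nat \<Rightarrow> 'i) \<Rightarrow> real ^ 'd" where
  "proj S \<omega> = lim (\<lambda>n. S_word S (map \<omega> [1..<Suc n]) 0)"

definition W_set ::
    "('i \<Rightarrow> real ^ 'd \<Rightarrow> real ^ 'd) \<Rightarrow> (nat \<Rightarrow> real ^ 'd) \<Rightarrow> (nat \<Rightarrow> (real ^ 'd) set) \<Rightarrow> (real ^ 'd) set" where
  "W_set S x E = {z \<in> attractor S.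
     infinite {w. w \<noteq> [] \<and> T_word S w z \<in> (+) (x (length w)) ` E (length w)}}"

definition R_set ::
    "('i \<Rightarrow> real ^ 'd \<Rightarrow> real ^ 'd) \<Rightarrow> (nat \<Rightarrow> (real ^ 'd) set) \<Rightarrow> (real ^ 'd) set" where
  "R_set S E = {z \<in> attractor S.
     infinite {w. w \<noteq> [] \<and> T_word S w z \<in> (+) z ` E (length w)}}"

definition W_ball ::
    "('i::finite \<Rightarrow> real ^ 'd ^ 'd) \<Rightarrow> (real ^ 'd) ^ 'i \<Rightarrow> real ^ 'd \<Rightarrow> real \<Rightarrow> (real ^ 'd) set" where
  "W_ball A t y C = {z \<in> attractor (ifs A t).
     infinite {w. w \<noteq> [] \<and> T_word (ifs A t) w z
       \<in> cball y ((C / lam A ^ length w) powr (1 / real CARD('d)))}}"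

definition admissible :: "('i::finite \<Rightarrow> real ^ 'd ^ 'd) \<Rightarrow> (nat \<Rightarrow> (real ^ 'd) set) \<Rightarrow> bool" where
  "admissible A E \<longleftrightarrow>
     (\<forall>n\<ge>1. E n \<in> sets borel) \<and>
     (\<exists>Q>0. \<forall>n\<ge>1. E n \<subseteq> cube Q) \<and>
     (\<forall>n\<ge>1. emeasure lebesgue (E n) = ennreal (1 / lam A ^ n)) \<and>
     (\<forall>n\<ge>1. \<forall>s\<in>{0<..<1}. (\<lambda>e. s *\<^sub>R e) ` E n \<subseteq> E n) \<and>
     (\<exists>C>0. \<forall>n\<ge>1. \<exists>r>0.
        emeasure lebesgue (mink_sum (cube r) (E n)) \<le> ennreal C * emeasure lebesgue (E n) \<and>
        emeasure lebesgue (mink_diff (cube r) (E n)) \<le> ennreal C * emeasure lebesgue (E n))"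

text \<open>
  The filter of \<open>V \<rightarrow> x\<close> with \<open>x \<in> V \<in> \<V>\<close>, where \<open>V \<rightarrow> x\<close> means that the diameter of
  \<open>V \<union> {x}\<close> tends to 0. Boundedness is explicit because \<^const>\<open>diameter\<close> is unspecified on
  unbounded sets. The filter is trivial if \<open>x\<close> lies in no arbitrarily small member of \<open>\<V>\<close>
  (possible only for \<open>x \<notin> X\<close> if \<open>\<V>\<close> is a density basis for \<open>X\<close>); the limit condition is then void.
\<close>

definition shrinking :: "'a::metric_space set set \<Rightarrow> 'a \<Rightarrow> 'a set filter" where
  "shrinking \<V> x =
     (INF \<delta>\<in>{0<..}. principal {V \<in> \<V>. x \<in> V \<and> bounded V \<and> diameter (insert x V) < \<delta>})"

definition density_basis :: "(real ^ 'd) set set \<Rightarrow> (real ^ 'd) set \<Rightarrow> bool" where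
  "density_basis \<V> X \<longleftrightarrow>
     (\<forall>V\<in>\<V>. open V) \<and>
     (\<forall>x\<in>X. \<forall>\<delta>>0. \<exists>V\<in>\<V>. x \<in> V \<and> bounded V \<and> diameter V < \<delta>) \<and>
     (\<forall>B. B \<in> sets borel \<and> B \<subseteq> X \<longrightarrow>
        (AE x in lebesgue.
           ((\<lambda>V. measure lebesgue (V \<inter> B) / measure lebesgue V) \<longlongrightarrow> indicator B x) (shrinking \<V> x)))"

definition differentiation_regular :: "('i \<Rightarrow> real ^ 'd \<Rightarrow> real ^ 'd) \<Rightarrow> bool" where
  "differentiation_regular S \<longleftrightarrow>
     emeasure lebesgue (attractor S) > 0 \<and>
     (\<exists>\<V> \<eta>. density_basis \<V> (attractor S) \<and> \<eta> > 0 \<and>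
        (\<forall>x\<in>attractor S. \<exists>V :: nat \<Rightarrow> (real ^ 'd) set.
           (\<forall>j. V j \<in> \<V> \<and> x \<in> V j) \<and>
           filterlim V (shrinking \<V> x) sequentially \<and>
           (\<forall>j. \<exists>w. w \<noteq> [] \<and> S_word S w ` attractor S \<subseteq> V j \<and>
              emeasure lebesgue (S_word S w ` attractor S) \<ge> ennreal \<eta> * emeasure lebesgue (V j))))"

end

theory Submission
  imports Defs "HOL-Library.Omega_Words_Fun"
begin

text \<open>
  For a word \<open>w = i\<^sub>1 \<dots> i\<^sub>n\<close> let \<open>A\<^sub>w\<close> be the product \<open>A i\<^sub>1 \<dots> A i\<^sub>n\<close>, let \<open>\<lambda>\<close> be \<open>lam A\<close>, and for an
  infinite word \<open>\<sigma>\<close> let \<open>\<pi>\<^sub>t \<sigma>\<close> (\<open>point A \<sigma> t\<close> below) be the point coded by \<open>\<sigma>\<close>. It is linear in \<open>t\<close>.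

  In every part, the points that a word \<open>w\<close> of length \<open>n\<close> moves into its target form a translate
  \<open>\<pi>\<^sub>t (w \<sigma>) + F\<^sub>w\<close> of a set \<open>F\<^sub>w\<close> that does not depend on \<open>t\<close> and whose measure is comparable to
  \<open>\<bar>det A\<^sub>w\<bar> / \<lambda>\<^sup>n\<close>. For a target \<open>\<pi>\<^sub>t \<sigma> + E\<^sub>n\<close> one has \<open>F\<^sub>w = A\<^sub>w E\<^sub>n\<close>. For recurrence, \<open>\<sigma>\<close> is the
  periodic word \<open>w w w \<dots>\<close>, which codes the fixed point of \<open>w\<close>, and \<open>F\<^sub>w = (1 - A\<^sub>w)\<^bsup>-1\<^esup> A\<^sub>w E\<^sub>n\<close>.
  The measures on level \<open>n\<close> add up to a constant, because the sum of \<open>\<bar>det A\<^sub>w\<bar>\<close> over the words of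
  length \<open>n\<close> is \<open>\<lambda>\<^sup>n\<close>. So the union over level \<open>n\<close> can be small only if the translates overlap a lot.

  Overlaps are rare for typical \<open>t\<close> by transversality. If \<open>w\<close> and \<open>w'\<close> have the longest common prefix
  \<open>v\<close>, then \<open>\<pi>\<^sub>t (w \<sigma>) - \<pi>\<^sub>t (w' \<sigma>')\<close> is \<open>A\<^sub>v\<close> applied to the difference for two words with distinct first
  letters. Since the norms are below \<open>1/2\<close>, this difference varies with nondegenerate derivative in at
  least one of the two translations named by these letters (\<open>transversal_direction\<close>). Hence the measure
  of the parameters \<open>t\<close> in a ball for which the difference lies in \<open>G\<close> is at most a constant times
  \<open>\<L> G / \<bar>det A\<^sub>v\<bar>\<close> (\<open>transversality\<close>). Integrated over \<open>t\<close>, the intersection of the sets of \<open>w\<close> and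
  \<open>w'\<close> has measure at most a constant times \<open>\<bar>det A\<^sub>w\<bar> \<bar>det A\<^sub>w\<^sub>'\<bar> / (\<bar>det A\<^sub>v\<bar> \<lambda>\<^bsup>2n\<^esup>)\<close>, and the sum of these
  bounds over all pairs is dominated by \<open>\<Sum>k. \<lambda>\<^bsup>-k\<^esup>\<close>, which is finite as \<open>\<lambda> > 1\<close> (\<open>sum_overlap_le\<close>).
  By Fatou's lemma the sum of the measures of pairwise intersections stays bounded along some
  subsequence of levels for almost every \<open>t\<close>, and the second moment inequality bounds the union
  from below on these levels (\<open>limsup_emeasure_word_targets_pos\<close>).

  The unions over the levels lie in one bounded set, so the points that belong to infinitely many of
  them have positive measure, too. They lie in the attractor, because a point that infinitely many
  words move into a bounded set is a limit of points of the attractor (\<open>word_targets_positive\<close>).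

  The set of the second part, the union over \<open>C\<close>, is mapped into itself by the functions of the
  iterated function system, because a word of length \<open>k\<close> only changes \<open>C\<close> to \<open>C \<lambda>\<^sup>k\<close>. It has positive
  measure, and its affine copies occupy a fixed proportion of arbitrarily small sets of the density
  basis at every point of the attractor. So its complement in the attractor has no density points
  and is null (\<open>full_measure_of_invariant\<close>).
\<close>

section \<open>Linear maps and Lebesgue measure\<close>

text \<open>
  A Borel measure is determined by its values on boxes, so it suffices to know what a linear map does
  to boxes. The cases of \<open>emeasure_linear_vimage\<close> for elementary matrices rest on this.
\<close>

lemma emeasure_vimage_if_image_cbox:
  fixes M M' :: "real ^ 'd ^ 'd"
  assumes M': "M ** M' = mat 1" "M' ** M = mat 1"
    and m: "\<And>a b. measure lebesgue ((*v) M' ` cbox a b) = m * measure lebesgue (cbox a b)"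
    and m0: "m > 0" and G: "G \<in> sets borel"
  shows "emeasure lborel ((*v) M -` G) = ennreal m * emeasure lborel G"
proof -
  have cont: "continuous_on UNIV ((*v) M)"
    by (intro linear_continuous_on matrix_vector_mul_bounded_linear)
  have meas: "(*v) M \<in> borel_measurable lborel"
    using borel_measurable_continuous_onI[OF cont] by simp
  let ?N = "density (distr lborel borel ((*v) M)) (\<lambda>_. ennreal (1 / m))"
  have emN: "emeasure ?N X = ennreal (1 / m) * emeasure lborel ((*v) M -` X)" if "X \<in> sets borel" for X
  proof -
    have "emeasure ?N X = ennreal (1 / m) * emeasure (distr lborel borel ((*v) M)) X"
      using that by (subst emeasure_density) (auto simp: nn_integral_cmult)
    then show ?thesis
      using that meas by (simp add: emeasure_distr)
  qed
  have inv: "ennreal m * ennreal (1 / m) = 1"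
    using m0 by (simp add: ennreal_mult[symmetric])
  have "lborel = ?N"
  proof (rule lborel_eqI)
    fix l u :: "real ^ 'd" assume le: "\<And>b. b \<in> Basis \<Longrightarrow> l \<bullet> b \<le> u \<bullet> b"
    have im: "(*v) M -` box l u = (*v) M' ` box l u"
    proof (intro equalityI subsetI)
      fix x assume "x \<in> (*v) M -` box l u"
      then have "M' *v (M *v x) \<in> (*v) M' ` box l u" by blast
      then show "x \<in> (*v) M' ` box l u" by (simp add: M' matrix_vector_mul_assoc)
    qed (auto simp: M' matrix_vector_mul_assoc)
    have bm: "(*v) M' ` box l u \<in> sets borel"
      unfolding im[symmetric] using measurable_sets_borel[OF _ borel_open[OF open_box]] meas by auto
    have suff: "(*v) M' ` box l u \<in> lmeasurable"
        "measure lebesgue ((*v) M' ` box l u) = m * measure lebesgue (box l u)"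
      using measure_linear_sufficient[OF matrix_vector_mul_linear[of M'] lmeasurable_box m] by auto
    have "emeasure lborel ((*v) M' ` box l u) = emeasure lebesgue ((*v) M' ` box l u)"
      using bm by simp
    also have "\<dots> = ennreal (m * measure lebesgue (box l u))"
      using suff by (simp add: emeasure_eq_measure2)
    finally have "emeasure lborel ((*v) M -` box l u) = ennreal m * ennreal (measure lebesgue (box l u))"
      using m0 by (simp add: im ennreal_mult)
    then have "emeasure ?N (box l u) = ennreal (measure lebesgue (box l u))"
      using inv by (subst emN) (auto simp: mult.assoc[symmetric] mult.commute)
    also have "\<dots> = (\<Prod>b\<in>Basis. (u - l) \<bullet> b)"
      using emeasure_lborel_box[OF le] by (simp add: emeasure_eq_measure2[symmetric])
    finally show "emeasure ?N (box l u) = (\<Prod>b\<in>Basis. (u - l) \<bullet> b)" .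
  qed simp
  then have "ennreal m * emeasure lborel G = (ennreal m * ennreal (1 / m)) * emeasure lborel ((*v) M -` G)"
    using emN[OF G] by (metis mult.assoc)
  then show ?thesis by (simp add: inv)
qed

lemma vimage_matrix_mult: "(*v) (M ** N) -` G = (*v) N -` ((*v) M -` G)"
  for M N :: "real ^ 'd ^ 'd"
  by (auto simp: matrix_vector_mul_assoc)

lemma borel_vimage_matrix:
  fixes M :: "real ^ 'd ^ 'e"
  assumes "G \<in> sets borel" shows "(*v) M -` G \<in> sets borel"
proof -
  have "continuous_on UNIV ((*v) M)"
    by (intro linear_continuous_on matrix_vector_mul_bounded_linear)
  then show ?thesis
    using assms measurable_sets_borel[OF borel_measurable_continuous_onI] by auto
qed

text \<open>
  The change of variables formula for invertible matrices, by factorization into elementary ones.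
  The preimage form makes it multiplicative for all Borel sets, of infinite measure as well.
\<close>

lemma emeasure_linear_vimage:
  fixes M :: "real ^ 'd ^ 'd" and G :: "(real ^ 'd) set"
  assumes "invertible M" and "G \<in> sets borel"
  shows "ennreal \<bar>det M\<bar> * emeasure lborel ((*v) M -` G) = emeasure lborel G"
  using assms
proof (induction M arbitrary: G rule: induct_matrix_elementary_alt)
  case (1 M N)
  then have inv: "invertible M" "invertible N"
    by (auto simp: invertible_det_nz det_mul)
  have "ennreal \<bar>det (M ** N)\<bar> = ennreal \<bar>det M\<bar> * ennreal \<bar>det N\<bar>"
    by (simp add: det_mul abs_mult ennreal_mult)
  moreover have "ennreal \<bar>det N\<bar> * emeasure lborel ((*v) (M ** N) -` G) = emeasure lborel ((*v) M -` G)"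
    unfolding vimage_matrix_mult using 1 inv borel_vimage_matrix by blast
  ultimately show ?case
    using 1 inv by (simp add: mult.assoc)
next
  case (2 M i)
  then have "det M = 0" by (simp add: det_zero_row)
  then show ?case using 2 by (simp add: invertible_det_nz)
next
  case (3 M)
  have det: "det M = (\<Prod>i\<in>UNIV. M $ i $ i)"
    using 3 by (intro det_diagonal) auto
  then have nz: "M $ i $ i \<noteq> 0" for i
    using 3 by (auto simp: invertible_det_nz)
  define c where "c i = 1 / M $ i $ i" for i
  define M' :: "real ^ 'd ^ 'd" where "M' = (\<chi> i j. if i = j then c i else 0)"
  have diag: "M = (\<chi> i j. if i = j then M $ i $ i else 0)"
    using 3 by (auto simp: vec_eq_iff)
  have inv: "M ** M' = mat 1" "M' ** M = mat 1"
    by (subst diag, use nz in \<open>simp add: M'_def c_def matrix_matrix_mult_def vec_eq_iff mat_def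
      if_distrib[of "\<lambda>x. y * x" for y] if_distribR cong: if_cong\<close>)+
  have M'x: "(*v) M' = (\<lambda>x. \<chi> k. c k * x $ k)"
    by (auto simp: M'_def matrix_vector_mult_def vec_eq_iff if_distrib[of "\<lambda>x. x * y" for y] cong: if_cong)
  have "\<bar>prod c UNIV\<bar> > 0" using nz by (simp add: c_def)
  then have "emeasure lborel ((*v) M -` G) = ennreal \<bar>prod c UNIV\<bar> * emeasure lborel G"
    using 3 by (intro emeasure_vimage_if_image_cbox[OF inv])
      (auto simp: M'x measure_stretch)
  moreover have "\<bar>det M\<bar> * \<bar>prod c UNIV\<bar> = 1"
    using nz by (simp add: det c_def abs_mult[symmetric] prod.distrib[symmetric])
  ultimately show ?case
    by (simp add: mult.assoc[symmetric] ennreal_mult[symmetric])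
next
  case (4 m n)
  let ?p = "Transposition.transpose m n"
  define P :: "real ^ 'd ^ 'd" where "P = (\<chi> i j. mat 1 $ i $ ?p j)"
  have Pv: "(*v) P = (\<lambda>x. \<chi> i. x $ ?p i)"
  proof (intro ext vec_eq_iff[THEN iffD2] allI)
    fix x :: "real ^ 'd" and i
    have "mat 1 $ i $ ?p j * x $ j = (if j = ?p i then x $ j else 0)" for j
      by (cases "j = ?p i") (auto simp: mat_def)
    then show "(P *v x) $ i = (\<chi> i. x $ ?p i) $ i"
      by (simp add: matrix_vector_mult_def P_def)
  qed
  have inv: "P ** P = mat 1"
    unfolding matrix_eq matrix_vector_mul_assoc[symmetric] Pv by (simp add: vec_eq_iff)
  have "det P = of_int (sign ?p) * det (mat 1 :: real ^ 'd ^ 'd)"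
    unfolding P_def by (rule det_permute_columns) (simp add: permutes_swap_id)
  then have det: "\<bar>det P\<bar> = 1" by (simp add: sign_swap_id abs_mult)
  have cb: "measure lebesgue ((*v) P ` cbox a b) = measure lebesgue (cbox a b)" for a b
  proof (cases "cbox a b = {}")
    case False
    have inj: "P *v (P *v x) = x" for x by (simp add: matrix_vector_mul_assoc inv)
    have mem: "P *v x \<in> cbox (P *v a) (P *v b) \<longleftrightarrow> x \<in> cbox a b" for x
    proof -
      have "x \<in> cbox a b" if h: "\<forall>i. a $ ?p i \<le> x $ ?p i \<and> x $ ?p i \<le> b $ ?p i"
        unfolding mem_box_cart
      proof
        fix i show "a $ i \<le> x $ i \<and> x $ i \<le> b $ i"
          using h[rule_format, of "?p i"] by simp
      qed
      moreover have "\<forall>i. a $ ?p i \<le> x $ ?p i \<and> x $ ?p i \<le> b $ ?p i" if "x \<in> cbox a b"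
        using that by (simp add: mem_box_cart)
      moreover have "P *v x \<in> cbox (P *v a) (P *v b)
          \<longleftrightarrow> (\<forall>i. a $ ?p i \<le> x $ ?p i \<and> x $ ?p i \<le> b $ ?p i)"
        by (simp add: Pv mem_box_cart)
      ultimately show ?thesis by argo
    qed
    have im: "(*v) P ` cbox a b = cbox (P *v a) (P *v b)"
    proof (intro equalityI subsetI)
      fix x assume "x \<in> cbox (P *v a) (P *v b)"
      then have "P *v x \<in> cbox a b" using mem[of "P *v x"] by (simp only: inj)
      then show "x \<in> (*v) P ` cbox a b" by (rule image_eqI[rotated]) (simp only: inj)
    qed (use mem in auto)
    have "cbox (P *v a) (P *v b) \<noteq> {}" using False unfolding im[symmetric] by simp
    then have "measure lborel (cbox (P *v a) (P *v b)) = (\<Prod>i\<in>UNIV. (P *v b) $ i - (P *v a) $ i)"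
      by (rule content_cbox_cart)
    also have "\<dots> = (\<Prod>i\<in>UNIV. (b - a) $ ?p i)"
      by (simp add: Pv)
    also have "\<dots> = (\<Prod>i\<in>UNIV. (b - a) $ i)"
      using prod.permute[OF permutes_swap_id[of m UNIV n], of "\<lambda>i. (b - a) $ i"] by (simp add: o_def)
    also have "\<dots> = measure lborel (cbox a b)"
      using False by (simp add: content_cbox_cart)
    finally show ?thesis unfolding im by simp
  qed simp
  have "emeasure lborel ((*v) P -` G) = ennreal 1 * emeasure lborel G"
    using 4 cb by (intro emeasure_vimage_if_image_cbox[OF inv inv]) auto
  then show ?case by (simp add: det P_def[symmetric])
next
  case (5 m n)
  define S :: "real ^ 'd ^ 'd" where "S = (\<chi> i j. of_bool (i = m \<and> j = n \<or> i = j))"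
  have Sv: "(*v) S = (\<lambda>x. \<chi> i. if i = m then x $ m + x $ n else x $ i)"
  proof (intro ext vec_eq_iff[THEN iffD2] allI)
    fix x :: "real ^ 'd" and i
    have "of_bool (i = m \<and> j = n \<or> i = j) * x $ j
        = (if i = m \<and> j = n then x $ j else 0) + (if i = j then x $ j else 0)" for j
      using 5(1) by auto
    then have "(S *v x) $ i = (\<Sum>j\<in>UNIV. if i = m \<and> j = n then x $ j else 0)
        + (\<Sum>j\<in>UNIV. if i = j then x $ j else 0)"
      by (simp add: S_def matrix_vector_mult_def sum.distrib)
    also have "(\<Sum>j\<in>UNIV. if i = m \<and> j = n then x $ j else 0) = (if i = m then x $ n else 0)"
      by (cases "i = m") auto
    finally show "(S *v x) $ i = (\<chi> i. if i = m then x $ m + x $ n else x $ i) $ i"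
      by auto
  qed
  have "S = (\<chi> k. if k = m then row m (mat 1) + 1 *s row n (mat 1) else row k (mat 1))"
    using 5 by (auto simp: S_def vec_eq_iff row_def mat_def)
  then have det: "det S = 1"
    using det_row_operation[OF 5(1), of "mat 1 :: real ^ 'd ^ 'd" 1] by (simp only: det_I)
  then obtain N where N: "S ** N = mat 1" "N ** S = mat 1"
    using invertible_det_nz[of S] by (auto simp: invertible_def)
  have cb: "measure lebesgue ((*v) S ` cbox a b) = measure lebesgue (cbox a b)" for a b
  proof (cases "cbox a b = {}")
    case False
    \<comment> \<open>A translation makes coordinate \<open>n\<close> nonnegative on the box, as \<open>measure_shear_interval\<close> requires.\<close>
    define v :: "real ^ 'd" where "v = - axis n (a $ n)"
    have ne: "cbox (v + a) (v + b) \<noteq> {}" "0 \<le> (v + a) $ n"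
      using False by (auto simp: box_ne_empty v_def inner_diff_left)
    have "(*v) S ` (+) v ` cbox a b = (+) (S *v v) ` (*v) S ` cbox a b"
      by (simp add: image_comp o_def matrix_vector_right_distrib)
    then have "measure lebesgue ((*v) S ` cbox a b) = measure lebesgue ((*v) S ` cbox (v + a) (v + b))"
      by (metis cbox_translation measure_translation)
    also have "\<dots> = measure lebesgue (cbox (v + a) (v + b))"
      unfolding Sv by (rule measure_shear_interval[OF 5(1) ne])
    also have "\<dots> = measure lebesgue (cbox a b)"
      by (metis cbox_translation measure_translation)
    finally show ?thesis .
  qed simp
  \<comment> \<open>The shear of boxes gives the claim for preimages under the inverse \<open>N\<close>; apply it to the preimage under \<open>S\<close>.\<close>
  have "emeasure lborel ((*v) N -` H) = emeasure lborel H" if "H \<in> sets borel" for H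
    using emeasure_vimage_if_image_cbox[OF N(2) N(1), of 1 H] cb that by auto
  from this[of "(*v) S -` G"] have "emeasure lborel ((*v) S -` G) = emeasure lborel G"
    using borel_vimage_matrix[OF 5(3), of S] vimage_matrix_mult[of S N G] N(1)
    by (simp add: vimage_def)
  then show ?case using det unfolding S_def[symmetric] by simp
qed

lemma emeasure_lborel_shift:
  fixes a :: "'a::euclidean_space"
  assumes "S \<in> sets borel"
  shows "emeasure lborel {x. x + a \<in> S} = emeasure lborel S"
proof -
  have "emeasure lborel S = emeasure (distr lborel borel ((+) a)) S"
    by (simp add: lborel_distr_plus)
  also have "\<dots> = emeasure lborel {x. x + a \<in> S}"
    using assms by (subst emeasure_distr) (auto simp: vimage_def add.commute)
  finally show ?thesis by simp
qed

lemma
  fixes M :: "real ^ 'd ^ 'd"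
  assumes M: "invertible M" and E: "E \<in> sets borel"
  shows borel_linear_image: "(*v) M ` E \<in> sets borel"
    and emeasure_linear_image: "emeasure lborel ((*v) M ` E) = ennreal \<bar>det M\<bar> * emeasure lborel E"
proof -
  obtain N where N: "M ** N = mat 1" "N ** M = mat 1"
    using M by (auto simp: invertible_def)
  have im: "(*v) M ` E = (*v) N -` E"
  proof (intro equalityI subsetI)
    fix x assume "x \<in> (*v) N -` E"
    moreover have "x = M *v (N *v x)" by (simp add: matrix_vector_mul_assoc N)
    ultimately show "x \<in> (*v) M ` E" by blast
  qed (auto simp: matrix_vector_mul_assoc N)
  show borel: "(*v) M ` E \<in> sets borel"
    unfolding im by (rule borel_vimage_matrix[OF E])
  have "(*v) M -` ((*v) M ` E) = E"
    unfolding im by (auto simp: matrix_vector_mul_assoc N)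
  then show "emeasure lborel ((*v) M ` E) = ennreal \<bar>det M\<bar> * emeasure lborel E"
    using emeasure_linear_vimage[OF M borel] by simp
qed

text \<open>
  The preimage of the ball of radius \<open>c\<close> lies in the unit ball, so the determinant can be read off from
  a comparison of volumes.
\<close>

lemma det_lower_bound:
  fixes M :: "real ^ 'd ^ 'd"
  assumes c: "0 < c" and M: "\<And>v. c * norm v \<le> norm (M *v v)"
  shows "invertible M" and "c ^ CARD('d) \<le> \<bar>det M\<bar>"
proof -
  have "v = 0" if "M *v v = 0" for v
    using M[of v] c that by (simp add: mult_le_0_iff)
  then have "inj ((*v) M)"
    by (simp add: linear_injective_0)
  then show inv: "invertible M"
    using det_nz_iff_inj[OF matrix_vector_mul_linear[of M]] by (simp add: invertible_det_nz)
  let ?b = "emeasure lborel (ball 0 1 :: (real ^ 'd) set)"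
  have "(*v) M -` ball 0 c \<subseteq> ball 0 1"
  proof
    fix v assume "v \<in> (*v) M -` ball 0 c"
    then have "c * norm v < c * 1" using M[of v] by simp
    then show "v \<in> ball 0 1" using c by simp
  qed
  then have "ennreal \<bar>det M\<bar> * emeasure lborel ((*v) M -` ball 0 c) \<le> ennreal \<bar>det M\<bar> * ?b"
    by (intro mult_left_mono emeasure_mono) auto
  then have le: "emeasure lborel (ball 0 c :: (real ^ 'd) set) \<le> ennreal \<bar>det M\<bar> * ?b"
    by (simp add: emeasure_linear_vimage[OF inv])
  have pos: "0 < unit_ball_vol (real CARD('d))" by simp
  have "c ^ CARD('d) * unit_ball_vol (real CARD('d)) \<le> \<bar>det M\<bar> * unit_ball_vol (real CARD('d))"
    using le c by (simp add: emeasure_ball ennreal_mult[symmetric] mult.commute)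
  then show "c ^ CARD('d) \<le> \<bar>det M\<bar>"
    using pos by simp
qed

lemma det_upper_bound:
  fixes M :: "real ^ 'd ^ 'd"
  assumes inv: "invertible M" and c: "0 < c" and M: "\<And>v. norm (M *v v) \<le> c * norm v"
  shows "\<bar>det M\<bar> \<le> c ^ CARD('d)"
proof -
  have "cball 0 1 \<subseteq> (*v) M -` cball 0 c"
  proof
    fix v :: "real ^ 'd" assume "v \<in> cball 0 1"
    then have "c * norm v \<le> c * 1" using c by (intro mult_left_mono) auto
    then show "v \<in> (*v) M -` cball 0 c" using M[of v] by simp
  qed
  then have "ennreal \<bar>det M\<bar> * emeasure lborel (cball 0 1 :: (real ^ 'd) set)
      \<le> ennreal \<bar>det M\<bar> * emeasure lborel ((*v) M -` cball 0 c)"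
    by (intro mult_left_mono emeasure_mono) (auto simp: borel_vimage_matrix)
  then have le: "ennreal \<bar>det M\<bar> * emeasure lborel (cball 0 1 :: (real ^ 'd) set)
      \<le> emeasure lborel (cball 0 c :: (real ^ 'd) set)"
    by (simp add: emeasure_linear_vimage[OF inv])
  have pos: "0 < unit_ball_vol (real CARD('d))" by simp
  have "\<bar>det M\<bar> * unit_ball_vol (real CARD('d)) \<le> c ^ CARD('d) * unit_ball_vol (real CARD('d))"
    using le c by (simp add: emeasure_cball ennreal_mult[symmetric] mult.commute)
  then show ?thesis using pos by simp
qed

lemma emeasure_lborel_prod_swap:
  fixes Q :: "('a::euclidean_space \<times> 'b::euclidean_space) set"
  assumes Q: "Q \<in> sets borel"
  shows "(\<integral>\<^sup>+a. emeasure lborel {b. (a, b) \<in> Q} \<partial>lborel) = (\<integral>\<^sup>+b. emeasure lborel {a. (a, b) \<in> Q} \<partial>lborel)"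
proof -
  have Q': "Q \<in> sets (lborel \<Otimes>\<^sub>M lborel)"
    using Q by (simp only: lborel_prod sets_lborel)
  show ?thesis
    using lborel.emeasure_pair_measure_alt[OF Q'] lborel_pair.emeasure_pair_measure_alt2[OF Q']
    by (simp add: vimage_def)
qed

lemma emeasure_cball_eq_measure:
  "emeasure lborel (cball a r) = ennreal (measure lborel (cball a r))"
  using emeasure_lborel_cball_finite[of a r]
  by (intro emeasure_eq_ennreal_measure) (auto simp: less_top)

section \<open>Second moments and limsup sets\<close>

text \<open>
  Integrate the pointwise inequality \<open>2 s N \<le> 1\<^sub>U + s\<^sup>2 N\<^sup>2\<close>, in which \<open>N\<close> counts the sets that contain the
  point and \<open>U\<close> is their union. With \<open>s\<close> chosen as the quotient of the first by the second moment this is the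
  Cauchy-Schwarz lower bound for the measure of \<open>U\<close>.
\<close>

lemma emeasure_Union_second_moment:
  assumes I: "finite I" and U: "\<And>i. i \<in> I \<Longrightarrow> U i \<in> sets M" and s: "0 \<le> s"
  shows "ennreal (2 * s) * (\<Sum>i\<in>I. emeasure M (U i))
    \<le> emeasure M (\<Union>i\<in>I. U i) + ennreal (s\<^sup>2) * (\<Sum>i\<in>I. \<Sum>j\<in>I. emeasure M (U i \<inter> U j))"
proof -
  have [measurable]: "\<And>i. i \<in> I \<Longrightarrow> U i \<in> sets M" by (rule U)
  have pt: "ennreal (2 * s) * (\<Sum>i\<in>I. indicator (U i) x)
     \<le> indicator (\<Union>i\<in>I. U i) x + ennreal (s\<^sup>2) * (\<Sum>i\<in>I. \<Sum>j\<in>I. indicator (U i \<inter> U j) x)" for x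
  proof -
    define N where "N = (\<Sum>i\<in>I. indicator (U i) x :: real)"
    have N0: "0 \<le> N" by (auto simp: N_def intro: sum_nonneg)
    have 1: "(\<Sum>i\<in>I. indicator (U i) x) = ennreal N"
      unfolding N_def by (subst sum_ennreal[symmetric]) (auto simp: ennreal_indicator)
    have 2: "(\<Sum>i\<in>I. \<Sum>j\<in>I. indicator (U i \<inter> U j) x) = ennreal (N * N)"
    proof -
      have "(\<Sum>i\<in>I. \<Sum>j\<in>I. indicator (U i \<inter> U j) x :: ennreal)
          = (\<Sum>i\<in>I. \<Sum>j\<in>I. indicator (U i) x * indicator (U j) x)"
        by (simp add: indicator_inter_arith)
      also have "\<dots> = ennreal N * ennreal N"
        unfolding 1[symmetric] by (simp add: sum_product)
      finally show ?thesis using N0 by (simp add: ennreal_mult')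
    qed
    have "2 * s * N \<le> indicator (\<Union>i\<in>I. U i) x + s\<^sup>2 * (N * N)"
    proof (cases "x \<in> (\<Union>i\<in>I. U i)")
      case True
      have "0 \<le> (1 - s * N)\<^sup>2" by simp
      then show ?thesis using True by (simp add: power2_eq_square algebra_simps)
    next
      case False
      then have "N = 0" by (auto simp: N_def)
      then show ?thesis by simp
    qed
    then have "ennreal (2 * s * N) \<le> ennreal (indicator (\<Union>i\<in>I. U i) x + s\<^sup>2 * (N * N))"
      by (rule ennreal_leI)
    then show ?thesis
      unfolding 1 2 using s N0 by (simp add: ennreal_mult' ennreal_plus ennreal_indicator del: ennreal_leI)
  qed
  have "ennreal (2 * s) * (\<Sum>i\<in>I. emeasure M (U i))
      = (\<integral>\<^sup>+x. ennreal (2 * s) * (\<Sum>i\<in>I. indicator (U i) x) \<partial>M)"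
    by (subst nn_integral_cmult) (auto simp: nn_integral_sum)
  also have "\<dots> \<le> (\<integral>\<^sup>+x. indicator (\<Union>i\<in>I. U i) x
       + ennreal (s\<^sup>2) * (\<Sum>i\<in>I. \<Sum>j\<in>I. indicator (U i \<inter> U j) x) \<partial>M)"
    by (intro nn_integral_mono pt)
  also have "\<dots> = emeasure M (\<Union>i\<in>I. U i)
       + ennreal (s\<^sup>2) * (\<Sum>i\<in>I. \<Sum>j\<in>I. emeasure M (U i \<inter> U j))"
  proof -
    have [measurable]: "(\<Union>i\<in>I. U i) \<in> sets M" using I U by auto
    have [measurable]: "(\<lambda>x. \<Sum>i\<in>I. \<Sum>j\<in>I. indicator (U i \<inter> U j) x :: ennreal) \<in> borel_measurable M"
      by (intro borel_measurable_sum borel_measurable_indicator) auto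
    have "(\<integral>\<^sup>+x. (\<Sum>i\<in>I. \<Sum>j\<in>I. indicator (U i \<inter> U j) x) \<partial>M) = (\<Sum>i\<in>I. \<Sum>j\<in>I. emeasure M (U i \<inter> U j))"
      by (subst nn_integral_sum, (intro borel_measurable_sum borel_measurable_indicator; auto))
         (intro sum.cong refl, subst nn_integral_sum, auto)
    then show ?thesis
      by (subst nn_integral_add) (auto simp: nn_integral_cmult)
  qed
  finally show ?thesis .
qed

lemma limsup_emeasure_le_infinitely_often:
  assumes U: "\<And>n::nat. U n \<in> sets M" and B: "B \<in> sets M" "emeasure M B < \<infinity>" "\<And>n. U n \<subseteq> B"
  shows "limsup (\<lambda>n. emeasure M (U n)) \<le> emeasure M {x. \<exists>\<^sub>\<infinity>n. x \<in> U n}"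
proof -
  define D where "D m = (\<Union>n\<in>{m..}. U n)" for m
  have Dm: "D m \<in> sets M" for m unfolding D_def using U by auto
  have eq: "{x. \<exists>\<^sub>\<infinity>n. x \<in> U n} = (\<Inter>m. D m)"
    by (auto simp: D_def INFM_nat_le)
  have "decseq D" by (fastforce simp: D_def decseq_def intro: order_trans)
  moreover have "emeasure M (D m) \<noteq> \<infinity>" for m
    using emeasure_mono[of "D m" B M] B by (auto simp: D_def UN_subset_iff top_unique)
  ultimately have lim: "(\<lambda>m. emeasure M (D m)) \<longlonglongrightarrow> emeasure M (\<Inter>m. D m)"
    using Dm by (intro Lim_emeasure_decseq) auto
  have "limsup (\<lambda>n. emeasure M (U n)) \<le> limsup (\<lambda>n. emeasure M (D n))"
    by (intro Limsup_mono always_eventually allI emeasure_mono Dm) (auto simp: D_def)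
  also have "\<dots> = emeasure M (\<Inter>m. D m)"
    using lim by (intro lim_imp_Limsup) auto
  finally show ?thesis by (simp add: eq)
qed

text \<open>
  Fatou's lemma on an exhausting sequence of balls.
\<close>

lemma AE_liminf_finite:
  fixes f :: "nat \<Rightarrow> 'a::euclidean_space \<Rightarrow> ennreal"
  assumes f: "\<And>n. f n \<in> borel_measurable borel"
    and bound: "\<And>R. \<exists>C<\<infinity>. \<forall>n. (\<integral>\<^sup>+t\<in>cball 0 R. f n t \<partial>lborel) \<le> C"
  shows "AE t in lborel. liminf (\<lambda>n. f n t) < \<infinity>"
proof -
  have "AE t in lborel. t \<in> cball 0 (real R) \<longrightarrow> liminf (\<lambda>n. f n t) < \<infinity>" for R :: nat
  proof -
    obtain C where C: "C < \<infinity>" "\<And>n. (\<integral>\<^sup>+t\<in>cball 0 (real R). f n t \<partial>lborel) \<le> C"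
      using bound by blast
    let ?g = "\<lambda>n t. f n t * indicator (cball 0 (real R)) t"
    have g: "?g n \<in> borel_measurable lborel" for n
      using f by (intro borel_measurable_times_ennreal borel_measurable_indicator) auto
    have "(\<integral>\<^sup>+t. liminf (\<lambda>n. ?g n t) \<partial>lborel) \<le> liminf (\<lambda>n. \<integral>\<^sup>+t. ?g n t \<partial>lborel)"
        by (intro nn_integral_liminf g)
    also have "\<dots> \<le> C"
      using C(2) by (intro Liminf_le) (auto intro: always_eventually)
    finally have "(\<integral>\<^sup>+t. liminf (\<lambda>n. ?g n t) \<partial>lborel) \<noteq> \<infinity>"
      using C(1) by (metis ennreal_top_neq_one infinity_ennreal_def leD order_le_less_trans order_less_irrefl)
    then have "AE t in lborel. liminf (\<lambda>n. ?g n t) \<noteq> \<infinity>"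
      by (intro nn_integral_PInf_AE borel_measurable_liminf g) auto
    then show ?thesis
      by eventually_elim (auto simp: top.not_eq_extremum)
  qed
  then have "AE t in lborel. \<forall>R::nat. t \<in> cball 0 (real R) \<longrightarrow> liminf (\<lambda>n. f n t) < \<infinity>"
    by (subst AE_all_countable) blast
  then show ?thesis
    by eventually_elim (use real_arch_simple in \<open>auto simp: dist_norm\<close>)
qed

section \<open>Coding by infinite words\<close>

fun mat_word :: "('i \<Rightarrow> real ^ 'd ^ 'd) \<Rightarrow> 'i list \<Rightarrow> real ^ 'd ^ 'd" where
  "mat_word A [] = mat 1"
| "mat_word A (i # w) = A i ** mat_word A w"

abbreviation jac :: "('i \<Rightarrow> real ^ 'd ^ 'd) \<Rightarrow> 'i list \<Rightarrow> real" where
  "jac A w \<equiv> \<bar>det (mat_word A w)\<bar>"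

text \<open>
  The point of the attractor with address \<open>\<sigma>\<close>, written as a series that displays its linear dependence
  on the translations. Addresses start at index 0 here, so \<open>proj (ifs A t) \<omega>\<close> is the point with the shifted
  address (\<open>proj_eq_point\<close>).
\<close>

definition point :: "('i \<Rightarrow> real ^ 'd ^ 'd) \<Rightarrow> (nat \<Rightarrow> 'i) \<Rightarrow> (real ^ 'd) ^ 'i \<Rightarrow> real ^ 'd" where
  "point A \<sigma> t = (\<Sum>k. mat_word A (prefix k \<sigma>) *v (t $ \<sigma> k))"

lemma S_word_simps [simp]:
  "S_word S [] x = x"
  "S_word S (i # w) x = S i (S_word S w x)"
  "S_word S (u @ w) x = S_word S u (S_word S w x)"
  by (simp_all add: S_word_def)

lemma T_word_append: "T_word S (u @ w) x = T_word S w (T_word S u x)"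
  by (simp add: T_word_def)

text \<open>
  Both maps have the linear part \<open>mat_word A w\<close>.
\<close>

lemma S_word_diff:
  "S_word (ifs A t) w x - S_word (ifs A t) w y = mat_word A w *v (x - y)"
proof (induction w)
  case (Cons i w)
  have "S_word (ifs A t) (i # w) x - S_word (ifs A t) (i # w) y
      = A i *v (S_word (ifs A t) w x - S_word (ifs A t) w y)"
    by (simp add: ifs_def matrix_vector_mult_diff_distrib)
  then show ?case by (simp add: Cons.IH matrix_vector_mul_assoc)
qed simp

lemma prefix_Suc_Cons: "prefix (Suc k) \<sigma> = \<sigma> 0 # prefix k (\<sigma> \<circ> Suc)"
  by (simp add: subsequence_def upt_conv_Cons map_Suc_upt[symmetric] del: upt_Suc)

lemma build_comp_Suc [simp]: "(i ## \<sigma>) \<circ> Suc = \<sigma>"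
  by (simp add: fun_eq_iff)

text \<open>
  The finitely many norms have a maximum \<open>\<rho>\<close>, so contraction is uniform.
\<close>

locale affine_contractions =
  fixes A :: "'i::finite \<Rightarrow> real ^ 'd ^ 'd" and \<rho> :: real
  assumes invertible: "\<And>i. invertible (A i)"
    and contraction: "\<And>i x. norm (A i *v x) \<le> \<rho> * norm x"
    and \<rho>: "0 \<le> \<rho>" "\<rho> < 1 / 2"
    and lam_gt_1: "lam A > 1"
begin

lemma invertible_mat_word: "invertible (mat_word A w)"
proof (induction w)
  case Nil
  then show ?case by (auto simp: invertible_def intro!: exI[of _ "mat 1"])
qed (auto simp: invertible invertible_mult)

lemma jac_pos: "jac A w > 0"
  using invertible_mat_word[of w] by (simp add: invertible_det_nz)

lemma jac_Cons: "jac A (i # w) = \<bar>det (A i)\<bar> * jac A w"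
  by (simp add: det_mul abs_mult)

lemma norm_mat_word: "norm (mat_word A w *v x) \<le> \<rho> ^ length w * norm x"
proof (induction w)
  case (Cons i w)
  have "norm (mat_word A (i # w) *v x) \<le> \<rho> * norm (mat_word A w *v x)"
    using contraction[of i "mat_word A w *v x"] by (simp add: matrix_vector_mul_assoc)
  also have "\<dots> \<le> \<rho> * (\<rho> ^ length w * norm x)"
    by (intro mult_left_mono Cons.IH \<rho>)
  finally show ?case by simp
qed simp

lemma point_summand_bound: "norm (mat_word A (prefix k \<sigma>) *v x) \<le> \<rho> ^ k * norm x"
  using norm_mat_word[of "prefix k \<sigma>" x] by simp

lemma geometric: "summable (\<lambda>k. \<rho> ^ k * c)" "(\<Sum>k. \<rho> ^ k * c) = c / (1 - \<rho>)"
  using \<rho> by (auto simp: suminf_geometric suminf_mult2[symmetric] summable_geometric intro!: summable_mult2)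

lemma point_summand_norm: "norm (mat_word A (prefix k \<sigma>) *v (t $ \<sigma> k)) \<le> \<rho> ^ k * norm t"
proof -
  have "\<rho> ^ k * norm (t $ \<sigma> k) \<le> \<rho> ^ k * norm t"
    using \<rho> by (intro mult_left_mono) (auto simp: Finite_Cartesian_Product.norm_nth_le)
  then show ?thesis using point_summand_bound order_trans by blast
qed

lemma summable_point: "summable (\<lambda>k. mat_word A (prefix k \<sigma>) *v (t $ \<sigma> k))"
  by (rule summable_comparison_test'[OF geometric(1)[of "norm t"], of 0]) (rule point_summand_norm)

lemma norm_point: "norm (point A \<sigma> t) \<le> 2 * norm t"
proof -
  have "norm (point A \<sigma> t) \<le> (\<Sum>k. \<rho> ^ k * norm t)"
    unfolding point_def by (rule norm_suminf_le[OF point_summand_norm geometric(1)])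
  also have "\<dots> = norm t / (1 - \<rho>)"
    by (rule geometric)
  also have "\<dots> \<le> 2 * norm t"
    using \<rho> mult_left_mono[of "1/2" "1 - \<rho>" "norm t"] by (simp add: field_simps)
  finally show ?thesis .
qed

lemma linear_point: "linear (point A \<sigma>)"
proof (rule linearI)
  show "point A \<sigma> (s + t) = point A \<sigma> s + point A \<sigma> t" for s t
    unfolding point_def suminf_add[OF summable_point summable_point]
    by (simp add: matrix_vector_right_distrib)
  show "point A \<sigma> (c *\<^sub>R t) = c *\<^sub>R point A \<sigma> t" for c t
    unfolding point_def using suminf_scaleR_right[OF summable_point, of c \<sigma> t]
    by (simp add: matrix_vector_mult_scaleR)
qed

lemma point_unroll: "point A \<sigma> t = ifs A t (\<sigma> 0) (point A (\<sigma> \<circ> Suc) t)"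
proof -
  let ?f = "\<lambda>k. mat_word A (prefix k (\<sigma> \<circ> Suc)) *v (t $ (\<sigma> \<circ> Suc) k)"
  let ?g = "\<lambda>k. mat_word A (prefix k \<sigma>) *v (t $ \<sigma> k)"
  have shift: "?g (Suc k) = A (\<sigma> 0) *v ?f k" for k
    unfolding prefix_Suc_Cons by (simp add: matrix_vector_mul_assoc)
  have "point A \<sigma> t = (\<Sum>k. ?g (Suc k)) + ?g 0"
    unfolding point_def using suminf_split_head[OF summable_point[of \<sigma> t]] by (simp only: diff_add_cancel)
  also have "\<dots> = (\<Sum>k. A (\<sigma> 0) *v ?f k) + t $ \<sigma> 0"
    unfolding shift by simp
  also have "(\<Sum>k. A (\<sigma> 0) *v ?f k) = A (\<sigma> 0) *v point A (\<sigma> \<circ> Suc) t"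
    unfolding point_def
    by (rule bounded_linear.suminf[OF matrix_vector_mul_bounded_linear summable_point, symmetric])
  finally show ?thesis by (simp add: ifs_def)
qed

lemma point_conc: "point A (w \<frown> \<sigma>) t = S_word (ifs A t) w (point A \<sigma> t)"
proof (induction w)
  case (Cons i w)
  show ?case
    by (subst point_unroll) (simp add: Cons.IH)
qed simp

lemma proj_eq_point: "proj (ifs A t) \<omega> = point A (\<omega> \<circ> Suc) t"
proof -
  let ?\<sigma> = "\<omega> \<circ> Suc"
  have word: "map \<omega> [1..<Suc n] = prefix n ?\<sigma>" for n
  proof -
    have "[1..<Suc n] = map Suc [0..<n]" by (simp only: map_Suc_upt One_nat_def)
    then show ?thesis by (simp only: map_map subsequence_def)
  qed
  have "norm (S_word (ifs A t) (prefix n ?\<sigma>) 0 - point A ?\<sigma> t) \<le> \<rho> ^ n * (2 * norm t)" for n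
  proof -
    have "point A ?\<sigma> t = S_word (ifs A t) (prefix n ?\<sigma>) (point A (suffix n ?\<sigma>) t)"
      by (metis point_conc prefix_suffix)
    then have "norm (S_word (ifs A t) (prefix n ?\<sigma>) 0 - point A ?\<sigma> t)
        = norm (mat_word A (prefix n ?\<sigma>) *v (0 - point A (suffix n ?\<sigma>) t))"
      by (simp add: S_word_diff)
    also have "\<dots> \<le> \<rho> ^ n * norm (0 - point A (suffix n ?\<sigma>) t)"
      by (rule point_summand_bound)
    also have "\<dots> \<le> \<rho> ^ n * (2 * norm t)"
      using \<rho> norm_point by (intro mult_left_mono) auto
    finally show ?thesis .
  qed
  then have ev: "\<forall>\<^sub>F n in sequentially.
      norm (S_word (ifs A t) (prefix n ?\<sigma>) 0 - point A ?\<sigma> t) \<le> \<rho> ^ n * (2 * norm t)"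
    by simp
  have "(\<lambda>n. \<rho> ^ n * (2 * norm t)) \<longlonglongrightarrow> 0"
    using \<rho> by (intro tendsto_mult_left_zero LIMSEQ_power_zero) auto
  then have "(\<lambda>n. S_word (ifs A t) (prefix n ?\<sigma>) 0 - point A ?\<sigma> t) \<longlonglongrightarrow> 0"
    by (rule Lim_null_comparison[OF ev])
  then have "(\<lambda>n. S_word (ifs A t) (prefix n ?\<sigma>) 0) \<longlonglongrightarrow> point A ?\<sigma> t"
    by (rule LIM_zero_cancel)
  then show ?thesis
    unfolding proj_def word by (rule limI)
qed

lemma bij_ifs: "bij (ifs A t i)"
proof -
  obtain B where B: "A i ** B = mat 1" "B ** A i = mat 1"
    using invertible[of i] by (auto simp: invertible_def)
  show ?thesis
  proof (rule o_bij)
    show "(\<lambda>x. B *v (x - t $ i)) \<circ> ifs A t i = id"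
      by (simp add: fun_eq_iff ifs_def matrix_vector_mul_assoc B)
    show "ifs A t i \<circ> (\<lambda>x. B *v (x - t $ i)) = id"
      by (simp add: fun_eq_iff ifs_def matrix_vector_mul_assoc B)
  qed
qed

lemma T_word_iff: "T_word (ifs A t) w x = y \<longleftrightarrow> x = S_word (ifs A t) w y"
proof (induction w arbitrary: x)
  case Nil
  then show ?case by (auto simp: T_word_def)
next
  case (Cons i w)
  have "T_word (ifs A t) (i # w) x = T_word (ifs A t) w (inv (ifs A t i) x)"
    by (simp add: T_word_def)
  also have "\<dots> = y \<longleftrightarrow> inv (ifs A t i) x = S_word (ifs A t) w y"
    by (rule Cons.IH)
  also have "\<dots> \<longleftrightarrow> x = ifs A t i (S_word (ifs A t) w y)"
    using bij_inv_eq_iff[OF bij_ifs, of "S_word (ifs A t) w y" t i x] by auto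
  finally show ?case by simp
qed

lemma T_S_word [simp]: "T_word (ifs A t) w (S_word (ifs A t) w x) = x"
  and S_T_word [simp]: "S_word (ifs A t) w (T_word (ifs A t) w x) = x"
  using T_word_iff[of t w "S_word (ifs A t) w x" x] T_word_iff[of t w x "T_word (ifs A t) w x"]
  by simp_all

end

section \<open>Transversality\<close>

text \<open>
  If moving \<open>t\<close> in the direction \<open>\<iota>\<close> changes \<open>L t\<close> at a rate bounded below, then \<open>L\<close> cannot spend too much
  time in a small set \<open>G\<close>. The measure of the parameters is unchanged when \<open>t\<close> is replaced by \<open>t + \<iota> v\<close>. Averaging
  over \<open>v\<close> in the unit ball and exchanging the integrals leaves, for fixed \<open>t\<close>, the measure of
  those \<open>v\<close> with \<open>M v + L t \<in> G\<close>, which is \<open>\<L> G / \<bar>det M\<bar>\<close>. The enlarged ball contains all \<open>t\<close> that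
  matter after the shift.
\<close>

lemma emeasure_transversality:
  fixes L :: "'a::euclidean_space \<Rightarrow> real ^ 'd" and \<iota> :: "real ^ 'd \<Rightarrow> 'a"
  assumes L: "linear L" and \<iota>: "linear \<iota>" "\<And>v. norm (\<iota> v) \<le> norm v"
    and M: "\<And>v. L (\<iota> v) = M *v v" "0 < c" "\<And>v. c * norm v \<le> norm (M *v v)"
    and G: "G \<in> sets borel"
  shows "ennreal (c ^ CARD('d)) * emeasure lborel (cball 0 1 :: (real ^ 'd) set)
      * emeasure lborel {t \<in> cball 0 R. L t \<in> G}
    \<le> emeasure lborel (cball 0 (R + 1) :: 'a set) * emeasure lborel G"
proof -
  let ?B = "cball 0 1 :: (real ^ 'd) set"
  let ?K = "cball 0 (R + 1) :: 'a set"
  have Lb [measurable]: "L \<in> borel_measurable borel"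
    by (intro borel_measurable_continuous_onI linear_continuous_on)
      (use L in \<open>simp add: linear_conv_bounded_linear\<close>)
  have \<iota>b [measurable]: "\<iota> \<in> borel_measurable borel"
    by (intro borel_measurable_continuous_onI linear_continuous_on)
      (use \<iota> in \<open>simp add: linear_conv_bounded_linear\<close>)
  have G' [measurable]: "G \<in> sets borel" by (rule G)
  have inv: "invertible M" and det: "c ^ CARD('d) \<le> \<bar>det M\<bar>"
    using det_lower_bound[of c M] M by auto
  define V where "V = {t \<in> cball 0 R. L t \<in> G}"
  have V [measurable]: "V \<in> sets borel" unfolding V_def by measurable
  define Q where "Q = {(v, t). v \<in> ?B \<and> t + \<iota> v \<in> V}"
  have Q: "Q \<in> sets borel"
  proof -
    have "Q = {p \<in> space (borel \<Otimes>\<^sub>M borel). norm (fst p) \<le> 1 \<and> snd p + \<iota> (fst p) \<in> V}"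
      by (auto simp: Q_def space_pair_measure)
    also have "\<dots> \<in> sets (borel \<Otimes>\<^sub>M borel)" by measurable
    finally show ?thesis by (simp only: borel_prod)
  qed
  have "emeasure lborel V * emeasure lborel ?B = (\<integral>\<^sup>+v. emeasure lborel V * indicator ?B v \<partial>lborel)"
    by (simp add: nn_integral_cmult_indicator)
  also have "\<dots> = (\<integral>\<^sup>+v. emeasure lborel {t. (v, t) \<in> Q} \<partial>lborel)"
    by (intro nn_integral_cong) (auto simp: Q_def emeasure_lborel_shift[OF V] split: split_indicator)
  also have "\<dots> = (\<integral>\<^sup>+t. emeasure lborel {v. (v, t) \<in> Q} \<partial>lborel)"
    by (rule emeasure_lborel_prod_swap[OF Q])
  finally have swap: "emeasure lborel V * emeasure lborel ?B = \<dots>" .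
  have slice: "ennreal (c ^ CARD('d)) * emeasure lborel {v. (v, t) \<in> Q} \<le> emeasure lborel G * indicator ?K t" for t
  proof (cases "t \<in> ?K")
    case True
    have G2: "{y. y + L t \<in> G} \<in> sets borel" by measurable
    have "{v. (v, t) \<in> Q} \<subseteq> (*v) M -` {y. y + L t \<in> G}"
      by (auto simp: Q_def V_def M(1)[symmetric] linear_add[OF L] add.commute)
    then have "ennreal (c ^ CARD('d)) * emeasure lborel {v. (v, t) \<in> Q}
        \<le> ennreal \<bar>det M\<bar> * emeasure lborel ((*v) M -` {y. y + L t \<in> G})"
      using det borel_vimage_matrix[OF G2, of M] by (intro mult_mono emeasure_mono ennreal_leI) auto
    also have "\<dots> = emeasure lborel {y. y + L t \<in> G}"
      by (rule emeasure_linear_vimage[OF inv G2])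
    also have "\<dots> = emeasure lborel G"
      by (rule emeasure_lborel_shift[OF G])
    finally show ?thesis using True by simp
  next
    case False
    have "norm t \<le> R + 1" if "(v, t) \<in> Q" for v
    proof -
      have "norm (t + \<iota> v) \<le> R" "norm (\<iota> v) \<le> 1"
        using that \<iota>(2)[of v] by (auto simp: Q_def V_def)
      then show ?thesis
        using norm_triangle_ineq4[of "t + \<iota> v" "\<iota> v"] by simp
    qed
    then have "{v. (v, t) \<in> Q} = {}" using False by auto
    then show ?thesis by simp
  qed
  have "ennreal (c ^ CARD('d)) * emeasure lborel ?B * emeasure lborel V
      = ennreal (c ^ CARD('d)) * (\<integral>\<^sup>+t. emeasure lborel {v. (v, t) \<in> Q} \<partial>lborel)"
    unfolding swap[symmetric] by (simp add: mult_ac)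
  also have "\<dots> = (\<integral>\<^sup>+t. ennreal (c ^ CARD('d)) * emeasure lborel {v. (v, t) \<in> Q} \<partial>lborel)"
  proof (intro nn_integral_cmult[symmetric])
    have "Q \<in> sets (lborel \<Otimes>\<^sub>M lborel)" using Q by (simp only: lborel_prod sets_lborel)
    from lborel_pair.measurable_emeasure_Pair2[OF this]
    show "(\<lambda>t. emeasure lborel {v. (v, t) \<in> Q}) \<in> borel_measurable lborel"
      by (simp add: vimage_def)
  qed
  also have "\<dots> \<le> (\<integral>\<^sup>+t. emeasure lborel G * indicator ?K t \<partial>lborel)"
    by (intro nn_integral_mono slice)
  also have "\<dots> = emeasure lborel ?K * emeasure lborel G"
    by (simp add: nn_integral_cmult_indicator mult.commute)
  finally show ?thesis by (simp add: V_def)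
qed

lemma linear_axis: "linear (axis i :: 'a::real_vector \<Rightarrow> 'a ^ 'n)"
  by (rule linearI) (auto simp: axis_def vec_eq_iff)

lemma norm_axis: "norm (axis i x :: 'a::real_normed_vector ^ 'n) = norm x"
proof -
  have "norm (axis i x :: 'a ^ 'n) = sqrt (\<Sum>j\<in>UNIV. if j = i then (norm x)\<^sup>2 else 0)"
    unfolding norm_vec_def L2_set_def by (intro arg_cong[where f = sqrt] sum.cong) (auto simp: axis_def)
  then show ?thesis by simp
qed

text \<open>
  The weight \<open>\<bar>det A\<^sub>w\<bar> \<bar>det A\<^sub>w\<^sub>'\<bar> / \<bar>det A\<^sub>v\<bar>\<close> of a pair of words of equal length with longest common prefix \<open>v\<close>,
  in recursive form. On a pair of equal words it is \<open>\<bar>det A\<^sub>w\<bar>\<close>.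
\<close>

fun overlap :: "('i \<Rightarrow> real ^ 'd ^ 'd) \<Rightarrow> 'i list \<Rightarrow> 'i list \<Rightarrow> real" where
  "overlap A (i # u) (j # v) =
    (if i = j then \<bar>det (A i)\<bar> * overlap A u v else jac A (i # u) * jac A (j # v))"
| "overlap A u v = 1"

context affine_contractions
begin

text \<open>
  A bound for the norm of the derivative of \<open>point A \<sigma>\<close> in the translation of letter \<open>i\<close>.
\<close>

definition letter_weight :: "(nat \<Rightarrow> 'i) \<Rightarrow> 'i \<Rightarrow> real" where
  "letter_weight \<sigma> i = (\<Sum>k. \<rho> ^ k * of_bool (\<sigma> k = i))"

lemma summable_letter_weight: "summable (\<lambda>k. \<rho> ^ k * of_bool (\<sigma> k = i))"
  using \<rho> by (intro summable_comparison_test'[OF geometric(1)[of 1], of 0]) auto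

text \<open>
  Distinct letters occupy distinct positions, so together they see every power of \<open>\<rho>\<close> at most once.
\<close>

lemma letter_weight_add_le:
  assumes "i \<noteq> j"
  shows "letter_weight \<sigma> i + letter_weight \<sigma> j \<le> 1 / (1 - \<rho>)"
proof -
  have "letter_weight \<sigma> i + letter_weight \<sigma> j
      = (\<Sum>k. \<rho> ^ k * of_bool (\<sigma> k = i) + \<rho> ^ k * of_bool (\<sigma> k = j))"
    unfolding letter_weight_def by (rule suminf_add[OF summable_letter_weight summable_letter_weight])
  also have "\<dots> \<le> (\<Sum>k. \<rho> ^ k * 1)"
    using \<rho> assms by (intro suminf_le summable_add summable_letter_weight geometric(1)) auto
  also have "\<dots> = 1 / (1 - \<rho>)" by (rule geometric(2))
  finally show ?thesis .
qed

lemma norm_point_axis: "norm (point A \<sigma> (axis i v)) \<le> letter_weight \<sigma> i * norm v"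
proof -
  have "norm (point A \<sigma> (axis i v)) \<le> (\<Sum>k. \<rho> ^ k * of_bool (\<sigma> k = i) * norm v)"
    unfolding point_def
  proof (rule norm_suminf_le)
    fix k
    show "norm (mat_word A (prefix k \<sigma>) *v (axis i v $ \<sigma> k)) \<le> \<rho> ^ k * of_bool (\<sigma> k = i) * norm v"
      using point_summand_bound[where k = k and \<sigma> = \<sigma> and x = v] by (auto simp: axis_def)
  qed (intro summable_mult2 summable_letter_weight)
  then show ?thesis
    by (simp add: letter_weight_def suminf_mult2[OF summable_letter_weight])
qed

definition \<kappa> :: real where "\<kappa> = 1 - \<rho> / (1 - \<rho>)"

lemma \<kappa>_pos: "0 < \<kappa>"
  using \<rho> by (simp add: \<kappa>_def field_simps)

text \<open>
  Let \<open>i\<close> and \<open>j\<close> be the first letters. In the direction of the translation of \<open>i\<close> the derivative of the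
  difference is the identity plus an error from the later occurrences of \<open>i\<close> in both words; in the direction of \<open>j\<close> it is minus the
  identity plus such an error. The two errors together are at most \<open>2 \<rho> / (1 - \<rho>)\<close>, so one of them is at most
  \<open>\<rho> / (1 - \<rho>)\<close>, which is below 1 because \<open>\<rho> < 1/2\<close>. The direction depends on the words, but the constant
  \<open>\<kappa>\<close> does not.
\<close>

lemma transversal_direction:
  assumes neq: "\<sigma> 0 \<noteq> \<sigma>' 0"
  obtains i where "\<And>v. \<kappa> * norm v \<le> norm (point A \<sigma> (axis i v) - point A \<sigma>' (axis i v))"
proof -
  define s where "s i = \<rho> * (letter_weight (\<sigma> \<circ> Suc) i + letter_weight (\<sigma>' \<circ> Suc) i)" for i
  have tail: "norm (A (\<tau> 0) *v point A (\<tau> \<circ> Suc) (axis i v)) \<le> \<rho> * (letter_weight (\<tau> \<circ> Suc) i * norm v)" for \<tau> i v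
    using contraction[of "\<tau> 0" "point A (\<tau> \<circ> Suc) (axis i v)"]
      mult_left_mono[OF norm_point_axis[of "\<tau> \<circ> Suc" i v] \<rho>(1)] by linarith
  have head: "(1 - s i) * norm v \<le> norm (point A \<sigma> (axis i v) - point A \<sigma>' (axis i v))"
    if i: "i = \<sigma> 0 \<or> i = \<sigma>' 0" for i v
  proof -
    let ?a = "A (\<sigma> 0) *v point A (\<sigma> \<circ> Suc) (axis i v)"
    let ?b = "A (\<sigma>' 0) *v point A (\<sigma>' \<circ> Suc) (axis i v)"
    let ?h = "axis i v $ \<sigma> 0 - axis i v $ \<sigma>' 0"
    have eq: "point A \<sigma> (axis i v) - point A \<sigma>' (axis i v) = ?h + (?a - ?b)"
      using point_unroll[of \<sigma> "axis i v"] point_unroll[of \<sigma>' "axis i v"] by (simp add: ifs_def)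
    have "norm ?h = norm v"
      using i neq by (auto simp: axis_def)
    moreover have "norm (?a - ?b) \<le> s i * norm v"
      using norm_triangle_ineq4[of ?a ?b] tail[of \<sigma> i v] tail[of \<sigma>' i v]
      by (simp add: s_def algebra_simps)
    moreover have "norm ?h - norm (?a - ?b) \<le> norm (?h + (?a - ?b))"
      by (rule norm_diff_ineq)
    ultimately show ?thesis
      unfolding eq left_diff_distrib by linarith
  qed
  have "s (\<sigma> 0) + s (\<sigma>' 0) = \<rho> * ((letter_weight (\<sigma> \<circ> Suc) (\<sigma> 0) + letter_weight (\<sigma> \<circ> Suc) (\<sigma>' 0))
      + (letter_weight (\<sigma>' \<circ> Suc) (\<sigma> 0) + letter_weight (\<sigma>' \<circ> Suc) (\<sigma>' 0)))"
    by (simp add: s_def algebra_simps)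
  also have "\<dots> \<le> \<rho> * (1 / (1 - \<rho>) + 1 / (1 - \<rho>))"
    by (intro mult_left_mono add_mono letter_weight_add_le neq \<rho>)
  also have "\<dots> = 2 * (\<rho> / (1 - \<rho>))" by simp
  finally have "s (\<sigma> 0) \<le> \<rho> / (1 - \<rho>) \<or> s (\<sigma>' 0) \<le> \<rho> / (1 - \<rho>)" by linarith
  then obtain i where i: "i = \<sigma> 0 \<or> i = \<sigma>' 0" "s i \<le> \<rho> / (1 - \<rho>)" by blast
  have "\<kappa> * norm v \<le> norm (point A \<sigma> (axis i v) - point A \<sigma>' (axis i v))" for v
  proof -
    have "\<kappa> * norm v \<le> (1 - s i) * norm v"
      using i(2) by (intro mult_right_mono) (auto simp: \<kappa>_def)
    then show ?thesis using head[OF i(1), of v] by linarith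
  qed
  then show thesis by (rule that)
qed

text \<open>
  The constant that \<open>emeasure_transversality\<close> gives for \<open>c = \<kappa>\<close>.
\<close>

definition trans_const :: "real \<Rightarrow> real" where
  "trans_const R = measure lborel (cball 0 (R + 1) :: ((real ^ 'd) ^ 'i) set)
     / (\<kappa> ^ CARD('d) * measure lborel (cball 0 1 :: (real ^ 'd) set))"

lemma trans_const_nonneg: "0 \<le> trans_const R"
  using \<kappa>_pos by (simp add: trans_const_def)

lemma transversality_first_letter:
  assumes neq: "\<sigma> 0 \<noteq> \<sigma>' 0" and G: "G \<in> sets borel"
  shows "emeasure lborel {t \<in> cball 0 R. point A \<sigma> t - point A \<sigma>' t \<in> G}
    \<le> ennreal (trans_const R) * emeasure lborel G"
proof -
  obtain i where i: "\<And>v. \<kappa> * norm v \<le> norm (point A \<sigma> (axis i v) - point A \<sigma>' (axis i v))"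
    using transversal_direction[of \<sigma> \<sigma>', OF neq] by blast
  define L where "L t = point A \<sigma> t - point A \<sigma>' t" for t
  have L: "linear L" unfolding L_def by (intro linear_compose_sub linear_point)
  have lin: "linear (\<lambda>v. L (axis i v))"
    using linear_compose[OF linear_axis L] by (simp add: o_def)
  define M where "M = matrix (\<lambda>v. L (axis i v))"
  have M: "L (axis i v) = M *v v" for v
    unfolding M_def by (simp add: matrix_works lin)
  let ?V = "{t \<in> cball 0 R. L t \<in> G}"
  define b where "b = \<kappa> ^ CARD('d) * measure lborel (cball 0 1 :: (real ^ 'd) set)"
  have b: "b > 0" using \<kappa>_pos by (simp add: b_def content_cball)
  have eb: "ennreal (\<kappa> ^ CARD('d)) * emeasure lborel (cball 0 1 :: (real ^ 'd) set) = ennreal b"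
    using \<kappa>_pos by (simp add: b_def ennreal_mult emeasure_cball_eq_measure)
  have "ennreal b * emeasure lborel ?V \<le> emeasure lborel (cball 0 (R + 1) :: ((real ^ 'd) ^ 'i) set) * emeasure lborel G"
    unfolding eb[symmetric]
    by (rule emeasure_transversality[OF L linear_axis _ M \<kappa>_pos _ G])
       (use i M in \<open>auto simp: norm_axis L_def\<close>)
  then have "ennreal (1 / b) * (ennreal b * emeasure lborel ?V)
      \<le> ennreal (1 / b) * (emeasure lborel (cball 0 (R + 1) :: ((real ^ 'd) ^ 'i) set) * emeasure lborel G)"
    by (intro mult_left_mono) auto
  also have "\<dots> = ennreal (trans_const R) * emeasure lborel G"
    using b by (simp add: trans_const_def b_def[symmetric] emeasure_cball_eq_measure
        mult.assoc[symmetric] ennreal_mult[symmetric])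
  finally show ?thesis
    using b by (simp add: L_def mult.assoc[symmetric] ennreal_mult[symmetric])
qed

lemma point_measurable [measurable]: "point A \<sigma> \<in> borel_measurable borel"
  by (intro borel_measurable_continuous_onI linear_continuous_on)
    (use linear_point in \<open>simp add: linear_conv_bounded_linear\<close>)

text \<open>
  A common first letter \<open>i\<close> factors out of the difference as \<open>A i\<close>, which multiplies \<open>\<L> G\<close> by \<open>1 / \<bar>det (A i)\<bar>\<close>; at the
  first distinct letters \<open>transversality_first_letter\<close> applies.
\<close>

lemma transversality:
  assumes "length w = length w'" "w \<noteq> w'" "G \<in> sets borel"
  shows "ennreal (jac A w * jac A w')
      * emeasure lborel {t \<in> cball 0 R. point A (w \<frown> \<sigma>) t - point A (w' \<frown> \<sigma>') t \<in> G}
    \<le> ennreal (trans_const R * overlap A w w') * emeasure lborel G"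
  using assms
proof (induction w w' arbitrary: G rule: list_induct2)
  case (Cons i u j v)
  show ?case
  proof (cases "i = j")
    case False
    then have "((i # u) \<frown> \<sigma>) 0 \<noteq> ((j # v) \<frown> \<sigma>') 0" by simp
    from transversality_first_letter[of "(i # u) \<frown> \<sigma>" "(j # v) \<frown> \<sigma>'", OF this Cons.prems(2), of R]
    have "ennreal (jac A (i # u) * jac A (j # v))
        * emeasure lborel {t \<in> cball 0 R. point A ((i # u) \<frown> \<sigma>) t - point A ((j # v) \<frown> \<sigma>') t \<in> G}
      \<le> ennreal (jac A (i # u) * jac A (j # v)) * (ennreal (trans_const R) * emeasure lborel G)"
      by (rule mult_left_mono) simp
    also have "\<dots> = ennreal (trans_const R * overlap A (i # u) (j # v)) * emeasure lborel G"
      using False by (simp add: ennreal_mult'' mult_ac del: mat_word.simps)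
    finally show ?thesis .
  next
    case True
    let ?a = "\<bar>det (A i)\<bar>"
    let ?G = "(*v) (A i) -` G"
    have "point A ((i # u) \<frown> \<sigma>) t - point A ((j # v) \<frown> \<sigma>') t = A i *v (point A (u \<frown> \<sigma>) t - point A (v \<frown> \<sigma>') t)" for t
      unfolding point_conc using True by (simp add: ifs_def matrix_vector_mult_diff_distrib)
    then have eq: "{t \<in> cball 0 R. point A ((i # u) \<frown> \<sigma>) t - point A ((j # v) \<frown> \<sigma>') t \<in> G}
        = {t \<in> cball 0 R. point A (u \<frown> \<sigma>) t - point A (v \<frown> \<sigma>') t \<in> ?G}" (is "_ = ?V")
      by simp
    have jac: "jac A (i # u) * jac A (j # v) = (?a * ?a) * (jac A u * jac A v)"
      using True unfolding jac_Cons by (simp add: mult_ac)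
    have "ennreal (jac A (i # u) * jac A (j # v)) = ennreal (?a * ?a) * ennreal (jac A u * jac A v)"
      unfolding jac by (rule ennreal_mult) simp_all
    then have "ennreal (jac A (i # u) * jac A (j # v)) * emeasure lborel ?V
        = ennreal (?a * ?a) * (ennreal (jac A u * jac A v) * emeasure lborel ?V)"
      by (simp only: mult.assoc)
    also have "\<dots> \<le> ennreal (?a * ?a) * (ennreal (trans_const R * overlap A u v) * emeasure lborel ?G)"
      using Cons True by (intro mult_left_mono Cons.IH borel_vimage_matrix) auto
    also have "\<dots> = ennreal (?a * (trans_const R * overlap A u v)) * (ennreal ?a * emeasure lborel ?G)"
    proof -
      have "ennreal (a * a) * ennreal x = ennreal (a * x) * ennreal a" if "0 \<le> a" for a x :: real
        using that by (simp add: ennreal_mult' mult_ac)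
      from this[of ?a "trans_const R * overlap A u v"] show ?thesis
        by (simp only: mult.assoc[symmetric] abs_ge_zero)
    qed
    also have "ennreal ?a * emeasure lborel ?G = emeasure lborel G"
      using Cons.prems by (intro emeasure_linear_vimage invertible) auto
    finally show ?thesis
      using True unfolding eq by (simp add: mult_ac del: mat_word.simps)
  qed
qed simp

text \<open>
  Translate by the first centre, so that only the difference of the centres depends on \<open>t\<close>. Then
  integrate over \<open>t\<close> before integrating over the point.
\<close>

lemma integral_intersection:
  assumes w: "length w = length w'" "w \<noteq> w'"
    and F: "F \<in> sets borel" "F' \<in> sets borel"
  shows "ennreal (jac A w * jac A w')
      * (\<integral>\<^sup>+t\<in>cball 0 R. emeasure lborel
           ({x. x - point A (w \<frown> \<sigma>) t \<in> F} \<inter> {x. x - point A (w' \<frown> \<sigma>') t \<in> F'}) \<partial>lborel)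
    \<le> ennreal (trans_const R * overlap A w w') * (emeasure lborel F * emeasure lborel F')"
proof -
  let ?D = "\<lambda>t. point A (w \<frown> \<sigma>) t - point A (w' \<frown> \<sigma>') t"
  note [measurable] = F
  define Q where "Q = {(t, y). t \<in> cball 0 R \<and> y \<in> F \<and> y + ?D t \<in> F'}"
  have Q: "Q \<in> sets borel"
  proof -
    have "Q = {p \<in> space (borel \<Otimes>\<^sub>M borel). norm (fst p) \<le> R \<and> snd p \<in> F \<and> snd p + ?D (fst p) \<in> F'}"
      by (auto simp: Q_def space_pair_measure)
    also have "\<dots> \<in> sets (borel \<Otimes>\<^sub>M borel)" by measurable
    finally show ?thesis by (simp only: borel_prod)
  qed
  have "emeasure lborel ({x. x - point A (w \<frown> \<sigma>) t \<in> F} \<inter> {x. x - point A (w' \<frown> \<sigma>') t \<in> F'}) * indicator (cball 0 R) t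
      = emeasure lborel {y. (t, y) \<in> Q}" for t
  proof (cases "t \<in> cball 0 R")
    case True
    let ?S = "{x. x - point A (w \<frown> \<sigma>) t \<in> F} \<inter> {x. x - point A (w' \<frown> \<sigma>') t \<in> F'}"
    have "?S \<in> sets borel" by measurable
    from emeasure_lborel_shift[OF this, of "point A (w \<frown> \<sigma>) t"] show ?thesis
      using True by (simp add: Q_def algebra_simps)
  qed (simp add: Q_def)
  then have "(\<integral>\<^sup>+t\<in>cball 0 R. emeasure lborel
           ({x. x - point A (w \<frown> \<sigma>) t \<in> F} \<inter> {x. x - point A (w' \<frown> \<sigma>') t \<in> F'}) \<partial>lborel)
      = (\<integral>\<^sup>+t. emeasure lborel {y. (t, y) \<in> Q} \<partial>lborel)"
    by simp
  also have "\<dots> = (\<integral>\<^sup>+y. emeasure lborel {t. (t, y) \<in> Q} \<partial>lborel)"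
    by (rule emeasure_lborel_prod_swap[OF Q])
  finally have "ennreal (jac A w * jac A w')
      * (\<integral>\<^sup>+t\<in>cball 0 R. emeasure lborel
           ({x. x - point A (w \<frown> \<sigma>) t \<in> F} \<inter> {x. x - point A (w' \<frown> \<sigma>') t \<in> F'}) \<partial>lborel)
      = ennreal (jac A w * jac A w') * (\<integral>\<^sup>+y. emeasure lborel {t. (t, y) \<in> Q} \<partial>lborel)"
    by simp
  also have "\<dots> = (\<integral>\<^sup>+y. ennreal (jac A w * jac A w') * emeasure lborel {t. (t, y) \<in> Q} \<partial>lborel)"
  proof (intro nn_integral_cmult[symmetric])
    have "Q \<in> sets (lborel \<Otimes>\<^sub>M lborel)" using Q by (simp only: lborel_prod sets_lborel)
    from lborel_pair.measurable_emeasure_Pair2[OF this]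
    show "(\<lambda>y. emeasure lborel {t. (t, y) \<in> Q}) \<in> borel_measurable lborel"
      by (simp add: vimage_def)
  qed
  also have "\<dots> \<le> (\<integral>\<^sup>+y. ennreal (trans_const R * overlap A w w') * emeasure lborel F' * indicator F y \<partial>lborel)"
  proof (intro nn_integral_mono)
    fix y
    show "ennreal (jac A w * jac A w') * emeasure lborel {t. (t, y) \<in> Q}
        \<le> ennreal (trans_const R * overlap A w w') * emeasure lborel F' * indicator F y"
    proof (cases "y \<in> F")
      case True
      have G: "{z. z + y \<in> F'} \<in> sets borel" by measurable
      have "{t. (t, y) \<in> Q} = {t \<in> cball 0 R. ?D t \<in> {z. z + y \<in> F'}}"
        using True by (auto simp: Q_def add.commute)
      then show ?thesis
        using True transversality[OF w G, of R \<sigma> \<sigma>'] by (simp add: emeasure_lborel_shift[OF F(2)])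
    qed (simp add: Q_def)
  qed
  also have "\<dots> = ennreal (trans_const R * overlap A w w') * (emeasure lborel F * emeasure lborel F')"
    using F by (subst nn_integral_cmult_indicator) (auto simp: mult_ac)
  finally show ?thesis .
qed

end

section \<open>Positive measure at infinitely many levels\<close>

lemma finite_words [simp]: "finite {w :: 'i::finite list. length w = n}"
  using finite_lists_length_eq[of "UNIV :: 'i set" n] by simp

lemma sum_words_Suc:
  fixes f :: "'i::finite list \<Rightarrow> 'b::comm_monoid_add"
  shows "(\<Sum>w | length w = Suc n. f w) = (\<Sum>i\<in>UNIV. \<Sum>w | length w = n. f (i # w))"
proof -
  have "(\<Sum>i\<in>UNIV. \<Sum>w | length w = n. f (i # w))
      = (\<Sum>(i, w)\<in>UNIV \<times> {w. length w = n}. f (i # w))"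
    by (rule sum.cartesian_product)
  also have "\<dots> = (\<Sum>w | length w = Suc n. f w)"
    by (rule sum.reindex_bij_witness[of _ "\<lambda>w. (hd w, tl w)" "\<lambda>(i, w). i # w"])
      (auto simp: length_Suc_conv)
  finally show ?thesis by simp
qed

lemma ennreal_le_divideI:
  assumes "0 < a" "ennreal a * x \<le> ennreal b"
  shows "x \<le> ennreal (b / a)"
proof -
  have "ennreal (1 / a) * (ennreal a * x) \<le> ennreal (1 / a) * ennreal b"
    by (rule mult_left_mono[OF assms(2)]) simp
  moreover have "ennreal (1 / a) * ennreal a = 1"
    using assms(1) by (simp add: ennreal_mult[symmetric])
  moreover have "ennreal (1 / a) * ennreal b = ennreal (b / a)"
    using assms(1) by (simp add: ennreal_mult'[symmetric])
  ultimately show ?thesis by (simp add: mult.assoc[symmetric])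
qed

context affine_contractions
begin

lemma overlap_nonneg: "0 \<le> overlap A u v"
  by (induction A u v rule: overlap.induct) auto

lemma sum_jac: "(\<Sum>w | length w = n. jac A w) = lam A ^ n"
proof (induction n)
  case 0
  have "{w :: 'i list. length w = 0} = {[]}" by auto
  then show ?case by simp
next
  case (Suc n)
  show ?case
    unfolding sum_words_Suc jac_Cons sum_distrib_left[symmetric] Suc.IH
    by (simp add: lam_def sum_distrib_right)
qed

text \<open>
  Pairs with distinct first letters contribute at most \<open>\<lambda>\<^bsup>2n\<^esup>\<close>, and pairs with a common one contribute \<open>\<lambda>\<close>
  times the sum of the previous level. The factor \<open>\<lambda> / (\<lambda> - 1)\<close> is the fixed point of this recursion after
  division by \<open>\<lambda>\<^bsup>2n\<^esup>\<close>.
\<close>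

lemma sum_overlap_le:
  "(\<Sum>w | length w = n. \<Sum>w' | length w' = n. overlap A w w') \<le> lam A / (lam A - 1) * lam A ^ (2 * n)"
proof (induction n)
  case 0
  have "{w :: 'i list. length w = 0} = {[]}" by auto
  then show ?case using lam_gt_1 by simp
next
  case (Suc n)
  let ?W = "{w :: 'i list. length w = n}" and ?l = "lam A"
  let ?R = "\<Sum>w\<in>?W. \<Sum>w'\<in>?W. overlap A w w'"
  have le: "overlap A (i # w) (j # w')
      \<le> (if i = j then \<bar>det (A i)\<bar> * overlap A w w' else 0) + jac A (i # w) * jac A (j # w')" for i j w w'
    by simp
  have swap: "(\<Sum>w\<in>?W. \<Sum>j\<in>UNIV. \<Sum>w'\<in>?W. h w j w') = (\<Sum>j\<in>UNIV. \<Sum>w\<in>?W. \<Sum>w'\<in>?W. h w j w')"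
    for h :: "'i list \<Rightarrow> 'i \<Rightarrow> 'i list \<Rightarrow> real"
    by (rule sum.swap)
  have "(\<Sum>w | length w = Suc n. \<Sum>w' | length w' = Suc n. overlap A w w')
      = (\<Sum>i\<in>UNIV. \<Sum>w\<in>?W. \<Sum>j\<in>UNIV. \<Sum>w'\<in>?W. overlap A (i # w) (j # w'))"
    by (simp only: sum_words_Suc)
  also have "\<dots> \<le> (\<Sum>i\<in>UNIV. \<Sum>w\<in>?W. \<Sum>j\<in>UNIV. \<Sum>w'\<in>?W.
       (if i = j then \<bar>det (A i)\<bar> * overlap A w w' else 0) + jac A (i # w) * jac A (j # w'))"
    by (intro sum_mono le)
  also have "\<dots> = (\<Sum>i\<in>UNIV. \<Sum>w\<in>?W. \<Sum>j\<in>UNIV. \<Sum>w'\<in>?W. if i = j then \<bar>det (A i)\<bar> * overlap A w w' else 0)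
      + (\<Sum>i\<in>UNIV. \<Sum>w\<in>?W. \<Sum>j\<in>UNIV. \<Sum>w'\<in>?W. jac A (i # w) * jac A (j # w'))"
    by (simp only: sum.distrib)
  also have "(\<Sum>i\<in>UNIV. \<Sum>w\<in>?W. \<Sum>j\<in>UNIV. \<Sum>w'\<in>?W. if i = j then \<bar>det (A i)\<bar> * overlap A w w' else 0)
      = ?l * ?R"
  proof -
    have "(\<Sum>j\<in>UNIV. \<Sum>w\<in>?W. \<Sum>w'\<in>?W. if i = j then \<bar>det (A i)\<bar> * overlap A w w' else 0) = \<bar>det (A i)\<bar> * ?R" for i
    proof -
      have "(\<Sum>w\<in>?W. \<Sum>w'\<in>?W. if i = j then \<bar>det (A i)\<bar> * overlap A w w' else 0)
          = (if j = i then \<bar>det (A i)\<bar> * ?R else 0)" for j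
        by (auto simp: sum_distrib_left)
      then show ?thesis by simp
    qed
    then show ?thesis by (simp only: swap lam_def sum_distrib_right)
  qed
  also have "(\<Sum>i\<in>UNIV. \<Sum>w\<in>?W. \<Sum>j\<in>UNIV. \<Sum>w'\<in>?W. jac A (i # w) * jac A (j # w'))
      = ?l ^ Suc n * ?l ^ Suc n"
    unfolding sum_jac[of "Suc n", symmetric] sum_words_Suc
    unfolding sum_distrib_right unfolding sum_distrib_left by (rule refl)
  also have "?l * ?R + ?l ^ Suc n * ?l ^ Suc n
      \<le> ?l * (?l / (?l - 1) * ?l ^ (2 * n)) + ?l ^ Suc n * ?l ^ Suc n"
    using lam_gt_1 Suc.IH by (intro add_right_mono mult_left_mono) auto
  also have "\<dots> = ?l / (?l - 1) * ?l ^ (2 * Suc n)"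
  proof -
    have "?l * (?l / (?l - 1)) + ?l * ?l = ?l / (?l - 1) * (?l * ?l)"
      using lam_gt_1 by (simp add: field_simps)
    moreover have "?l * (?l / (?l - 1) * ?l ^ (2 * n)) + ?l ^ Suc n * ?l ^ Suc n
        = (?l * (?l / (?l - 1)) + ?l * ?l) * ?l ^ (2 * n)"
      by (simp add: power_mult power2_eq_square power_mult_distrib algebra_simps)
    ultimately show ?thesis by (simp add: mult_ac)
  qed
  finally show ?case .
qed

text \<open>
  The second moment argument for the translates \<open>point A (w \<frown> \<tau> w) t + F w\<close>. The continuation \<open>\<tau> w\<close> of the
  address may depend on \<open>w\<close>, since transversality depends only on the first letter at which two words differ.
\<close>

lemma limsup_emeasure_word_targets_pos:
  fixes \<tau> :: "'i list \<Rightarrow> nat \<Rightarrow> 'i" and F :: "'i list \<Rightarrow> (real ^ 'd) set"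
  assumes F: "\<And>w. w \<noteq> [] \<Longrightarrow> F w \<in> sets borel"
    and m: "\<And>w. w \<noteq> [] \<Longrightarrow> emeasure lborel (F w) = ennreal (m w)"
    and c: "0 < c\<^sub>1" "\<And>w. w \<noteq> [] \<Longrightarrow> c\<^sub>1 * (jac A w / lam A ^ length w) \<le> m w"
      "\<And>w. w \<noteq> [] \<Longrightarrow> m w \<le> c\<^sub>2 * (jac A w / lam A ^ length w)"
  shows "AE t in lborel. limsup (\<lambda>n. emeasure lborel
      (\<Union>w\<in>{w. length w = n}. {x. x - point A (w \<frown> \<tau> w) t \<in> F w})) > 0"
proof -
  define U where "U w t = {x. x - point A (w \<frown> \<tau> w) t \<in> F w}" for w t
  \<comment> \<open>Levels are shifted by one, as the empty word carries no assumption.\<close>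
  define W where "W n = {w :: 'i list. length w = Suc n}" for n
  define f where "f n t = (\<Sum>w\<in>W n. \<Sum>w'\<in>W n. emeasure lborel (U w t \<inter> U w' t))" for n t
  have lam: "lam A > 0" using lam_gt_1 by simp
  have W: "finite (W n)" "w \<in> W n \<Longrightarrow> w \<noteq> []" "w \<in> W n \<Longrightarrow> length w = Suc n" for n w
    by (auto simp: W_def)
  have jacp: "0 < jac A w" for w by (rule jac_pos)
  have m0: "0 \<le> m w" if "w \<noteq> []" for w
  proof -
    have "0 \<le> c\<^sub>1 * (jac A w / lam A ^ length w)"
      using c(1) lam jacp[of w] by (intro mult_nonneg_nonneg divide_nonneg_pos) auto
    then show ?thesis using c(2)[OF that] by linarith
  qed
  have U: "U w t \<in> sets borel" if "w \<noteq> []" for w t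
  proof -
    have [measurable]: "F w \<in> sets borel" by (rule F[OF that])
    show ?thesis unfolding U_def by measurable
  qed
  have emU: "emeasure lborel (U w t) = ennreal (m w)" if "w \<noteq> []" for w t
    using emeasure_lborel_shift[OF F[OF that], of "- point A (w \<frown> \<tau> w) t"] m[OF that]
    by (simp add: U_def)
  have measI: "(\<lambda>t. emeasure lborel (U w t \<inter> U w' t)) \<in> borel_measurable borel"
    if "w \<noteq> []" "w' \<noteq> []" for w w'
  proof -
    have [measurable]: "F w \<in> sets borel" "F w' \<in> sets borel" using F that by auto
    let ?Q = "{p \<in> space (borel \<Otimes>\<^sub>M borel). snd p - point A (w \<frown> \<tau> w) (fst p) \<in> F w
       \<and> snd p - point A (w' \<frown> \<tau> w') (fst p) \<in> F w'}"
    have "?Q \<in> sets (borel \<Otimes>\<^sub>M borel)" by measurable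
    then have "?Q \<in> sets (lborel \<Otimes>\<^sub>M lborel)"
      by (simp only: lborel_prod sets_lborel borel_prod)
    from lborel_pair.measurable_emeasure_Pair1[OF this]
    have "(\<lambda>t. emeasure lborel (Pair t -` ?Q)) \<in> borel_measurable borel" by simp
    also have "(\<lambda>t. emeasure lborel (Pair t -` ?Q)) = (\<lambda>t. emeasure lborel (U w t \<inter> U w' t))"
      by (intro ext arg_cong2[where f = emeasure]) (auto simp: U_def space_pair_measure)
    finally show ?thesis .
  qed
  have fin: "AE t in lborel. liminf (\<lambda>n. f n t) < \<infinity>"
  proof (rule AE_liminf_finite)
    show "f n \<in> borel_measurable borel" for n
      unfolding f_def by (intro borel_measurable_sum measI W)
  next
    fix R :: real
    define V where "V = measure lborel (cball 0 R :: ((real ^ 'd) ^ 'i) set)"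
    have V: "emeasure lborel (cball 0 R :: ((real ^ 'd) ^ 'i) set) = ennreal V"
      unfolding V_def by (rule emeasure_cball_eq_measure)
    have V0: "0 \<le> V" by (simp add: V_def)
    define C where "C = V * c\<^sub>2 + trans_const R * c\<^sub>2\<^sup>2 * (lam A / (lam A - 1))"
    have "(\<integral>\<^sup>+t\<in>cball 0 R. f n t \<partial>lborel) \<le> ennreal C" for n
    proof -
      define q where "q = lam A ^ Suc n"
      have q: "q > 0" using lam by (simp add: q_def)
      define b where "b w w' = (if w = w' then V * c\<^sub>2 * (jac A w / q) else 0)
         + trans_const R * c\<^sub>2\<^sup>2 / q\<^sup>2 * overlap A w w'" for w w'
      have offdiag_nonneg: "0 \<le> trans_const R * c\<^sub>2\<^sup>2 / q\<^sup>2 * overlap A w w'" for w w'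
        by (intro mult_nonneg_nonneg divide_nonneg_nonneg trans_const_nonneg overlap_nonneg) auto
      have bound: "(\<integral>\<^sup>+t\<in>cball 0 R. emeasure lborel (U w t \<inter> U w' t) \<partial>lborel) \<le> ennreal (b w w')"
        and b0: "0 \<le> b w w'"
        if w: "w \<in> W n" "w' \<in> W n" for w w'
      proof -
        have mw: "m w \<le> c\<^sub>2 * (jac A w / q)" "m w' \<le> c\<^sub>2 * (jac A w' / q)" "0 \<le> m w" "0 \<le> m w'"
          using c(3)[of w] c(3)[of w'] w W(2,3) m0 by (auto simp: q_def)
        have *: "(\<integral>\<^sup>+t\<in>cball 0 R. emeasure lborel (U w t \<inter> U w' t) \<partial>lborel) \<le> ennreal (b w w') \<and> 0 \<le> b w w'"
        proof (cases "w = w'")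
          case True
          have "(\<integral>\<^sup>+t\<in>cball 0 R. emeasure lborel (U w t \<inter> U w' t) \<partial>lborel) = ennreal (m w) * ennreal V"
            using True emU[OF W(2)[OF w(1)]] by (simp add: nn_integral_cmult_indicator V)
          also have "\<dots> = ennreal (V * m w)"
            using V0 by (simp add: ennreal_mult' mult.commute)
          also have "\<dots> \<le> ennreal (V * (c\<^sub>2 * (jac A w / q)))"
            using V0 mw by (intro ennreal_leI mult_left_mono)
          also have "\<dots> \<le> ennreal (b w w')"
            using True offdiag_nonneg[of w w'] by (intro ennreal_leI) (simp add: b_def)
          finally show ?thesis
            using mult_left_mono[OF mw(1) V0] mult_nonneg_nonneg[OF V0 mw(3)] offdiag_nonneg[of w w'] True
            by (simp add: b_def)
        next
          case False
          have len: "length w = length w'" using W(3) w by simp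
          have jj: "0 < jac A w * jac A w'" using jacp by (intro mult_pos_pos)
          have "ennreal (jac A w * jac A w')
              * (\<integral>\<^sup>+t\<in>cball 0 R. emeasure lborel (U w t \<inter> U w' t) \<partial>lborel)
            \<le> ennreal (trans_const R * overlap A w w') * (emeasure lborel (F w) * emeasure lborel (F w'))"
            unfolding U_def
            by (rule integral_intersection[OF len False F[OF W(2)[OF w(1)]] F[OF W(2)[OF w(2)]]])
          also have "\<dots> = ennreal (trans_const R * overlap A w w' * (m w * m w'))"
            using mw m w W(2) trans_const_nonneg[of R] overlap_nonneg[of w w'] by (simp add: ennreal_mult)
          finally have "(\<integral>\<^sup>+t\<in>cball 0 R. emeasure lborel (U w t \<inter> U w' t) \<partial>lborel)
              \<le> ennreal (trans_const R * overlap A w w' * (m w * m w') / (jac A w * jac A w'))"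
            by (rule ennreal_le_divideI[OF jj])
          also have "\<dots> \<le> ennreal (b w w')"
          proof (rule ennreal_leI)
            have mm: "m w * m w' \<le> (c\<^sub>2 * (jac A w / q)) * (c\<^sub>2 * (jac A w' / q))"
              using mw by (intro mult_mono) auto
            have "trans_const R * overlap A w w' * (m w * m w')
                \<le> trans_const R * overlap A w w' * ((c\<^sub>2 * (jac A w / q)) * (c\<^sub>2 * (jac A w' / q)))"
              by (intro mult_left_mono mm mult_nonneg_nonneg trans_const_nonneg overlap_nonneg)
            also have "\<dots> = b w w' * (jac A w * jac A w')"
              using False by (simp add: b_def power2_eq_square)
            finally show "trans_const R * overlap A w w' * (m w * m w') / (jac A w * jac A w') \<le> b w w'"
              using jj by (simp only: pos_divide_le_eq)
          qed
          finally show ?thesis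
            using offdiag_nonneg[of w w'] False by (simp add: b_def)
        qed
        show "(\<integral>\<^sup>+t\<in>cball 0 R. emeasure lborel (U w t \<inter> U w' t) \<partial>lborel) \<le> ennreal (b w w')" "0 \<le> b w w'"
          using * by auto
      qed
      have meas: "(\<lambda>t. emeasure lborel (U w t \<inter> U w' t) * indicator (cball 0 R) t) \<in> borel_measurable lborel"
        if "w \<in> W n" "w' \<in> W n" for w w'
        using measI[of w w'] W(2) that by (intro borel_measurable_times_ennreal borel_measurable_indicator) auto
      have "(\<integral>\<^sup>+t\<in>cball 0 R. f n t \<partial>lborel)
          = (\<integral>\<^sup>+t. (\<Sum>w\<in>W n. \<Sum>w'\<in>W n. emeasure lborel (U w t \<inter> U w' t) * indicator (cball 0 R) t) \<partial>lborel)"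
        by (simp add: f_def sum_distrib_right)
      also have "\<dots> = (\<Sum>w\<in>W n. \<integral>\<^sup>+t. (\<Sum>w'\<in>W n. emeasure lborel (U w t \<inter> U w' t) * indicator (cball 0 R) t) \<partial>lborel)"
        by (intro nn_integral_sum borel_measurable_sum meas)
      also have "\<dots> = (\<Sum>w\<in>W n. \<Sum>w'\<in>W n. \<integral>\<^sup>+t\<in>cball 0 R. emeasure lborel (U w t \<inter> U w' t) \<partial>lborel)"
        by (intro sum.cong refl nn_integral_sum meas)
      also have "\<dots> \<le> (\<Sum>w\<in>W n. \<Sum>w'\<in>W n. ennreal (b w w'))"
        by (intro sum_mono bound)
      also have "\<dots> = ennreal (\<Sum>w\<in>W n. \<Sum>w'\<in>W n. b w w')"
        using b0 by (simp add: sum_nonneg)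
      also have "\<dots> \<le> ennreal C"
      proof (rule ennreal_leI)
        have "(\<Sum>w\<in>W n. \<Sum>w'\<in>W n. b w w')
            = (\<Sum>w\<in>W n. V * c\<^sub>2 * (jac A w / q)) + trans_const R * c\<^sub>2\<^sup>2 / q\<^sup>2 * (\<Sum>w\<in>W n. \<Sum>w'\<in>W n. overlap A w w')"
          unfolding b_def sum.distrib sum_distrib_left using W(1)[of n] by simp
        also have "(\<Sum>w\<in>W n. V * c\<^sub>2 * (jac A w / q)) = V * c\<^sub>2"
          using sum_jac[of "Suc n"] lam
          by (simp add: sum_distrib_left[symmetric] sum_divide_distrib[symmetric] W_def q_def)
        also have "trans_const R * c\<^sub>2\<^sup>2 / q\<^sup>2 * (\<Sum>w\<in>W n. \<Sum>w'\<in>W n. overlap A w w')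
            \<le> trans_const R * c\<^sub>2\<^sup>2 / q\<^sup>2 * (lam A / (lam A - 1) * lam A ^ (2 * Suc n))"
          unfolding W_def
          by (intro mult_left_mono sum_overlap_le divide_nonneg_nonneg mult_nonneg_nonneg trans_const_nonneg) auto
        also have "lam A ^ (2 * Suc n) = q\<^sup>2"
          unfolding q_def power_mult[symmetric] by (simp only: mult.commute)
        also have "trans_const R * c\<^sub>2\<^sup>2 / q\<^sup>2 * (lam A / (lam A - 1) * q\<^sup>2)
            = trans_const R * c\<^sub>2\<^sup>2 * (lam A / (lam A - 1))"
          using q by simp
        finally show "(\<Sum>w\<in>W n. \<Sum>w'\<in>W n. b w w') \<le> C" by (simp add: C_def)
      qed
      finally show ?thesis .
    qed
    then show "\<exists>C<\<infinity>. \<forall>n. (\<integral>\<^sup>+t\<in>cball 0 R. f n t \<partial>lborel) \<le> C"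
      by (intro exI[of _ "ennreal C"]) auto
  qed
  show ?thesis
    using fin
  proof eventually_elim
    fix t assume "liminf (\<lambda>n. f n t) < \<infinity>"
    then obtain x where x: "liminf (\<lambda>n. f n t) = ennreal x" "0 \<le> x"
      by (cases "liminf (\<lambda>n. f n t)") auto
    define M where "M = x + 1"
    have M: "liminf (\<lambda>n. f n t) < ennreal M" "0 < M"
      using x by (simp_all add: M_def ennreal_less_iff)
    define g where "g n = emeasure lborel (\<Union>w\<in>{w. length w = n}. U w t)" for n
    \<comment> \<open>The value that the second moment inequality yields for \<open>s = c\<^sub>1 / M\<close>.\<close>
    define \<delta> where "\<delta> = c\<^sub>1\<^sup>2 / M"
    have \<delta>: "\<delta> > 0" using c(1) M(2) by (simp add: \<delta>_def)
    have freq: "\<exists>\<^sub>F n in sequentially. f n t < ennreal M"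
    proof (rule ccontr)
      assume "\<not> (\<exists>\<^sub>F n in sequentially. f n t < ennreal M)"
      then have "\<forall>\<^sub>F n in sequentially. ennreal M \<le> f n t"
        by (simp add: not_frequently not_less)
      then have "ennreal M \<le> liminf (\<lambda>n. f n t)" by (rule Liminf_bounded)
      then show False using M(1) by simp
    qed
    have lower: "ennreal \<delta> \<le> g (Suc n)" if n: "f n t < ennreal M" for n
    proof -
      let ?s = "c\<^sub>1 / M"
      have s: "0 \<le> ?s" using c(1) M(2) by simp
      have "c\<^sub>1 * (\<Sum>w\<in>W n. jac A w / lam A ^ Suc n) \<le> (\<Sum>w\<in>W n. m w)"
        unfolding sum_distrib_left using c(2) W(2,3) by (intro sum_mono) metis
      moreover have "(\<Sum>w\<in>W n. jac A w / lam A ^ Suc n) = 1"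
        using sum_jac[of "Suc n"] lam by (simp add: W_def sum_divide_distrib[symmetric])
      ultimately have "c\<^sub>1 \<le> (\<Sum>w\<in>W n. m w)" by simp
      then have "ennreal c\<^sub>1 \<le> (\<Sum>w\<in>W n. ennreal (m w))"
        using m0 W(2) by (subst sum_ennreal) (auto intro: ennreal_leI)
      also have "\<dots> = (\<Sum>w\<in>W n. emeasure lborel (U w t))"
        using emU W(2) by (intro sum.cong) auto
      finally have "ennreal (2 * ?s) * ennreal c\<^sub>1 \<le> ennreal (2 * ?s) * (\<Sum>w\<in>W n. emeasure lborel (U w t))"
        by (intro mult_left_mono) auto
      also have "\<dots> \<le> emeasure lborel (\<Union>w\<in>W n. U w t) + ennreal (?s\<^sup>2) * f n t"
        unfolding f_def using U W by (intro emeasure_Union_second_moment s) auto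
      also have "\<dots> \<le> g (Suc n) + ennreal (?s\<^sup>2) * ennreal M"
        using n unfolding g_def W_def by (intro add_mono mult_left_mono order.refl) auto
      also have "ennreal (?s\<^sup>2) * ennreal M = ennreal \<delta>"
        using M(2) by (simp add: \<delta>_def ennreal_mult[symmetric] power2_eq_square)
      also have "ennreal (2 * ?s) * ennreal c\<^sub>1 = ennreal \<delta> + ennreal \<delta>"
        using M(2) c(1) by (simp add: \<delta>_def ennreal_mult[symmetric] ennreal_plus[symmetric] power2_eq_square del: ennreal_plus)
      finally have "ennreal \<delta> + ennreal \<delta> \<le> ennreal \<delta> + g (Suc n)"
        unfolding add.commute[of "g (Suc n)" "ennreal \<delta>"] .
      then show "ennreal \<delta> \<le> g (Suc n)"
        by (simp add: ennreal_add_left_cancel_le)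
    qed
    have "ennreal \<delta> \<le> limsup g"
    proof (rule ccontr)
      assume "\<not> ennreal \<delta> \<le> limsup g"
      then have "\<forall>\<^sub>F n in sequentially. g n < ennreal \<delta>"
        by (intro Limsup_lessD) simp
      then have "\<forall>\<^sub>F n in sequentially. g (Suc n) < ennreal \<delta>"
        using eventually_sequentially_Suc[of "\<lambda>n. g n < ennreal \<delta>"] by simp
      then have "\<forall>\<^sub>F n in sequentially. \<not> f n t < ennreal M"
      proof (rule eventually_mono, intro notI)
        fix n assume "g (Suc n) < ennreal \<delta>" "f n t < ennreal M"
        from order.strict_trans1[OF lower[OF this(2)] this(1)] show False by simp
      qed
      then show False using freq by (simp add: frequently_def)
    qed
    moreover have "0 < ennreal \<delta>" using \<delta> by simp
    ultimately have "0 < limsup g" by (rule order_less_le_trans[rotated])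
    then show "limsup (\<lambda>n. emeasure lborel
      (\<Union>w\<in>{w. length w = n}. {x. x - point A (w \<frown> \<tau> w) t \<in> F w})) > 0"
      by (simp add: g_def[abs_def] U_def)
  qed
qed

end

section \<open>The attractor and points hit infinitely often\<close>

lemma infinitely_many_words_iff:
  fixes P :: "'i::finite list \<Rightarrow> bool"
  shows "infinite {w. w \<noteq> [] \<and> P w} \<longleftrightarrow> (\<exists>\<^sub>\<infinity>n. \<exists>w. length w = n \<and> P w)"
proof -
  let ?N = "{n. \<exists>w. length w = n \<and> P w}"
  have "finite {w. w \<noteq> [] \<and> P w} \<longleftrightarrow> finite ?N"
  proof
    assume "finite {w. w \<noteq> [] \<and> P w}"
    then have "finite (insert 0 (length ` {w. w \<noteq> [] \<and> P w}))" by simp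
    then show "finite ?N" by (rule finite_subset[rotated]) force
  next
    assume "finite ?N"
    then have "finite (\<Union>n\<in>?N. {w :: 'i list. length w = n})" by simp
    then show "finite {w. w \<noteq> [] \<and> P w}" by (rule finite_subset[rotated]) auto
  qed
  then show ?thesis by (simp add: frequently_cofinite)
qed

context affine_contractions
begin

lemma dist_S_word: "dist (S_word (ifs A t) w x) (S_word (ifs A t) w y) \<le> \<rho> ^ length w * dist x y"
  using norm_mat_word[of w "x - y"] by (simp add: dist_norm S_word_diff)

lemma S_word_invariant:
  assumes "\<And>i. ifs A t i ` Y \<subseteq> Y" "y \<in> Y" shows "S_word (ifs A t) w y \<in> Y"
  using assms by (induction w) auto

text \<open>
  If \<open>w\<close> moves \<open>x\<close> to a point at bounded distance from some \<open>y \<in> Y\<close>, then \<open>S\<^sub>w y\<close> is a point of \<open>Y\<close> at distance at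
  most a constant times \<open>\<rho>\<^bsup>length w\<^esup>\<close> from \<open>x\<close>. This gives the uniqueness of the attractor, and it places the
  points that are hit infinitely often in the attractor.
\<close>

lemma mem_closed_invariant:
  assumes Y: "closed Y" "Y \<noteq> {}" "\<And>i. ifs A t i ` Y \<subseteq> Y"
    and x: "\<exists>\<^sub>\<infinity>n. \<exists>w. length w = n \<and> norm (T_word (ifs A t) w x) \<le> R"
  shows "x \<in> Y"
proof -
  obtain y where y: "y \<in> Y" using Y by blast
  have lim: "(\<lambda>n. \<rho> ^ n * (R + norm y)) \<longlonglongrightarrow> 0"
    using \<rho> by (intro tendsto_mult_left_zero LIMSEQ_power_zero) auto
  have "\<exists>z\<in>Y. dist z x < e" if "e > 0" for e
  proof -
    have "\<forall>\<^sub>F n in sequentially. \<rho> ^ n * (R + norm y) < e"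
      using order_tendstoD(2)[OF lim that] .
    then obtain N where N: "\<And>n. n \<ge> N \<Longrightarrow> \<rho> ^ n * (R + norm y) < e"
      by (auto simp: eventually_sequentially)
    obtain w where w: "length w \<ge> N" "norm (T_word (ifs A t) w x) \<le> R"
      using x unfolding INFM_nat_le by blast
    let ?u = "T_word (ifs A t) w x"
    have "dist (S_word (ifs A t) w y) x = dist (S_word (ifs A t) w y) (S_word (ifs A t) w ?u)"
      by simp
    also have "\<dots> \<le> \<rho> ^ length w * dist y ?u" by (rule dist_S_word)
    also have "\<dots> \<le> \<rho> ^ length w * (R + norm y)"
    proof -
      have "dist y ?u \<le> R + norm y"
        using norm_triangle_ineq4[of y ?u] w(2) by (simp add: dist_norm)
      then show ?thesis using \<rho> by (intro mult_left_mono) auto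
    qed
    also have "\<dots> < e" using N[OF w(1)] .
    finally show ?thesis using S_word_invariant[OF Y(3) y] by blast
  qed
  then have "x \<in> closure Y" by (simp add: closure_approachable)
  then show ?thesis using Y(1) by simp
qed

lemma continuous_ifs: "continuous_on B (ifs A t i)"
  unfolding ifs_def
  by (intro continuous_on_add continuous_on_const linear_continuous_on matrix_vector_mul_bounded_linear)

lemma invariant_subset:
  assumes X: "compact X" "X = (\<Union>i. ifs A t i ` X)"
    and Y: "closed Y" "Y \<noteq> {}" "Y = (\<Union>i. ifs A t i ` Y)"
  shows "X \<subseteq> Y"
proof
  fix x assume x: "x \<in> X"
  have pull: "\<exists>w. length w = n \<and> T_word (ifs A t) w x \<in> X" for n
  proof -
    have "\<exists>w. length w = n \<and> x \<in> S_word (ifs A t) w ` X" if "x \<in> X" for x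
      using that
    proof (induction n arbitrary: x)
      case (Suc n)
      then obtain i x' where x': "x' \<in> X" "x = ifs A t i x'" using X(2) by blast
      then obtain w where "length w = n" "x' \<in> S_word (ifs A t) w ` X" using Suc.IH by blast
      then show ?case using x' by (intro exI[of _ "i # w"]) auto
    qed simp
    then show ?thesis using x by fastforce
  qed
  obtain R where "\<And>z. z \<in> X \<Longrightarrow> norm z \<le> R"
    using compact_imp_bounded[OF X(1)] by (auto simp: bounded_iff)
  then have "\<exists>\<^sub>\<infinity>n. \<exists>w. length w = n \<and> norm (T_word (ifs A t) w x) \<le> R"
    unfolding INFM_nat_le using pull by blast
  then show "x \<in> Y"
    using Y by (intro mem_closed_invariant[of Y t x R]) auto
qed

text \<open>
  A large ball is mapped into itself, and the intersection of its iterated images is invariant: a point of all images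
  lies, by the pigeonhole principle, in infinitely many of the images under one and the same \<open>S\<^sub>i\<close>.
\<close>

lemma exists_invariant:
  "\<exists>X. X \<noteq> {} \<and> compact X \<and> X = (\<Union>i. ifs A t i ` X)"
proof -
  let ?S = "ifs A t"
  define K where "K = rec_nat (cball 0 (2 * norm t)) (\<lambda>_ B. \<Union>i. ?S i ` B)"
  have K: "K 0 = cball 0 (2 * norm t)" "K (Suc n) = (\<Union>i. ?S i ` K n)" for n
    by (simp_all add: K_def)
  have "?S i x \<in> K 0" if "x \<in> K 0" for i x
  proof -
    have "norm (?S i x) \<le> norm (A i *v x) + norm (t $ i)"
      unfolding ifs_def by (rule norm_triangle_ineq)
    also have "\<dots> \<le> \<rho> * norm x + norm t"
      by (intro add_mono contraction Finite_Cartesian_Product.norm_nth_le)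
    also have "\<dots> \<le> 1 / 2 * (2 * norm t) + norm t"
      using that \<rho> by (intro add_right_mono mult_mono) (auto simp: K)
    finally show ?thesis by (simp add: K)
  qed
  then have base: "K (Suc 0) \<subseteq> K 0" by (auto simp: K(2))
  have dec: "K (Suc n) \<subseteq> K n" for n
  proof (induction n)
    case (Suc n)
    then show ?case by (simp only: K(2)) blast
  qed (rule base)
  have antimono: "K n \<subseteq> K m" if "m \<le> n" for m n
  proof -
    have "decseq K" using dec by (intro decseq_SucI)
    then show ?thesis using that by (rule decseqD)
  qed
  have comp: "compact (K n)" for n
    by (induction n) (auto simp: K intro!: compact_UN compact_continuous_image continuous_ifs)
  have ne: "K n \<noteq> {}" for n
    by (induction n) (auto simp: K)
  let ?X = "\<Inter>n. K n"
  have "?X \<noteq> {}"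
    by (intro compact_nest comp ne antimono)
  moreover have "compact ?X"
    by (intro compact_Inter) (use comp in auto)
  moreover have "?X = (\<Union>i. ?S i ` ?X)"
  proof (intro equalityI subsetI)
    fix x assume x: "x \<in> ?X"
    have inf: "\<exists>\<^sub>\<infinity>n. \<exists>i. x \<in> ?S i ` K n"
      unfolding INFM_nat_le
    proof
      fix m
      have "x \<in> K (Suc m)" using x by blast
      then show "\<exists>n\<ge>m. \<exists>i. x \<in> ?S i ` K n" by (auto simp: K(2))
    qed
    then obtain i where i: "\<exists>\<^sub>\<infinity>n. x \<in> ?S i ` K n"
      using INFM_finite_Bex_distrib[of "UNIV :: 'i set" "\<lambda>i n. x \<in> ?S i ` K n"] by auto
    let ?y = "inv (?S i) x"
    have "?y \<in> K m" for m
    proof -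
      obtain n where n: "n \<ge> m" "x \<in> ?S i ` K n" using i unfolding INFM_nat_le by blast
      then obtain y where "y \<in> K n" "x = ?S i y" by blast
      then show ?thesis
        using antimono[OF n(1)] inv_f_f[OF bij_is_inj[OF bij_ifs[of t i]]] by auto
    qed
    moreover have "x = ?S i ?y"
      using surj_f_inv_f[OF bij_is_surj[OF bij_ifs[of t i]], of x] by simp
    ultimately show "x \<in> (\<Union>i. ?S i ` ?X)" by blast
  next
    fix x assume "x \<in> (\<Union>i. ?S i ` ?X)"
    then obtain i y where y: "\<And>n. y \<in> K n" "x = ?S i y" by blast
    have "x \<in> K (Suc n)" for n using y unfolding K(2) by blast
    then show "x \<in> ?X" using dec by blast
  qed
  ultimately show ?thesis by blast
qed

lemma
  shows attractor_nonempty: "attractor (ifs A t) \<noteq> {}"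
    and compact_attractor: "compact (attractor (ifs A t))"
    and attractor_eq: "attractor (ifs A t) = (\<Union>i. ifs A t i ` attractor (ifs A t))"
proof -
  let ?P = "\<lambda>X. X \<noteq> {} \<and> compact X \<and> X = (\<Union>i. ifs A t i ` X)"
  have "\<exists>!X. ?P X"
  proof (rule ex_ex1I)
    show "\<exists>X. ?P X" by (rule exists_invariant)
    show "X = Y" if X: "?P X" and Y: "?P Y" for X Y
    proof
      show "X \<subseteq> Y"
        by (rule invariant_subset[of X t Y]) (use X Y compact_imp_closed in blast)+
      show "Y \<subseteq> X"
        by (rule invariant_subset[of Y t X]) (use X Y compact_imp_closed in blast)+
    qed
  qed
  from theI'[OF this] have "?P (attractor (ifs A t))"
    unfolding attractor_def .
  then show "attractor (ifs A t) \<noteq> {}" "compact (attractor (ifs A t))"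
    "attractor (ifs A t) = (\<Union>i. ifs A t i ` attractor (ifs A t))" by blast+
qed

lemma ifs_attractor_subset: "ifs A t i ` attractor (ifs A t) \<subseteq> attractor (ifs A t)"
  using attractor_eq[of t] by blast

lemma mem_attractorI:
  assumes "\<exists>\<^sub>\<infinity>n. \<exists>w. length w = n \<and> norm (T_word (ifs A t) w x) \<le> R"
  shows "x \<in> attractor (ifs A t)"
  by (rule mem_closed_invariant[OF compact_imp_closed[OF compact_attractor] attractor_nonempty ifs_attractor_subset assms])

text \<open>
  The common form of the shrinking target and the recurrence problem: \<open>P t w x\<close> says that \<open>w\<close> moves \<open>x\<close> into
  its target. The bounds with \<open>Q\<close> ensure that, for fixed \<open>t\<close>, all points that are hit lie in one ball and are moved
  to points of bounded norm, so that \<open>mem_closed_invariant\<close> applies.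
\<close>

lemma word_targets_positive:
  fixes \<tau> :: "'i list \<Rightarrow> nat \<Rightarrow> 'i" and F :: "'i list \<Rightarrow> (real ^ 'd) set"
    and P :: "(real ^ 'd) ^ 'i \<Rightarrow> 'i list \<Rightarrow> real ^ 'd \<Rightarrow> bool"
  assumes P: "\<And>t w x. w \<noteq> [] \<Longrightarrow> P t w x \<longleftrightarrow> x - point A (w \<frown> \<tau> w) t \<in> F w"
    and PT: "\<And>t w x. w \<noteq> [] \<Longrightarrow> P t w x \<Longrightarrow> norm (T_word (ifs A t) w x) \<le> norm x + 2 * norm t + Q"
    and FQ: "\<And>w. w \<noteq> [] \<Longrightarrow> F w \<subseteq> cball 0 Q"
    and F: "\<And>w. w \<noteq> [] \<Longrightarrow> F w \<in> sets borel"
    and m: "\<And>w. w \<noteq> [] \<Longrightarrow> emeasure lborel (F w) = ennreal (m w)"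
    and c: "0 < c\<^sub>1" "\<And>w. w \<noteq> [] \<Longrightarrow> c\<^sub>1 * (jac A w / lam A ^ length w) \<le> m w"
      "\<And>w. w \<noteq> [] \<Longrightarrow> m w \<le> c\<^sub>2 * (jac A w / lam A ^ length w)"
  shows "(AE t in lebesgue. limsup (\<lambda>n. emeasure lebesgue {x. \<exists>w. length w = n \<and> P t w x}) > 0)
    \<and> (AE t in lebesgue. emeasure lebesgue
      {x \<in> attractor (ifs A t). infinite {w. w \<noteq> [] \<and> P t w x}} > 0)"
proof -
  let ?V = "\<lambda>t n. {x. \<exists>w. length w = n \<and> P t w x}"
  have V: "?V t n = (\<Union>w\<in>{w. length w = n}. {x. x - point A (w \<frown> \<tau> w) t \<in> F w})" if "n > 0" for t n
    using that P by (auto 4 3)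
  have Vb: "?V t n \<in> sets borel" if "n > 0" for t n
    unfolding V[OF that]
  proof (intro sets.finite_UN finite_words)
    fix w :: "'i list" assume "w \<in> {w. length w = n}"
    then have "F w \<in> sets borel" using that by (intro F) auto
    then show "{x. x - point A (w \<frown> \<tau> w) t \<in> F w} \<in> sets borel" by measurable
  qed
  have "AE t in lborel. limsup (\<lambda>n. emeasure lborel
      (\<Union>w\<in>{w. length w = n}. {x. x - point A (w \<frown> \<tau> w) t \<in> F w})) > 0"
  proof (rule limsup_emeasure_word_targets_pos[of F m c\<^sub>1 c\<^sub>2 \<tau>])
    show "F w \<in> sets borel" if "w \<noteq> []" for w by (rule F[OF that])
    show "emeasure lborel (F w) = ennreal (m w)" if "w \<noteq> []" for w by (rule m[OF that])
    show "0 < c\<^sub>1" by (rule c(1))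
    show "c\<^sub>1 * (jac A w / lam A ^ length w) \<le> m w" if "w \<noteq> []" for w by (rule c(2)[OF that])
    show "m w \<le> c\<^sub>2 * (jac A w / lam A ^ length w)" if "w \<noteq> []" for w by (rule c(3)[OF that])
  qed
  then have pos: "AE t in lborel. limsup (\<lambda>n. emeasure lborel (?V t n)) > 0"
  proof eventually_elim
    fix t
    assume "0 < limsup (\<lambda>n. emeasure lborel
        (\<Union>w\<in>{w. length w = n}. {x. x - point A (w \<frown> \<tau> w) t \<in> F w}))"
    also have "\<dots> = limsup (\<lambda>n. emeasure lborel (?V t n))"
      by (rule Limsup_eq, rule eventually_mono[OF eventually_gt_at_top[of 0]]) (simp only: V)
    finally show "0 < limsup (\<lambda>n. emeasure lborel (?V t n))" .
  qed
  have leb: "limsup (\<lambda>n. emeasure lebesgue (?V t n)) = limsup (\<lambda>n. emeasure lborel (?V t n))" for t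
    by (rule Limsup_eq, rule eventually_mono[OF eventually_gt_at_top[of 0]]) (simp add: Vb)
  have limsup_pos: "AE t in lebesgue. limsup (\<lambda>n. emeasure lebesgue (?V t n)) > 0"
    unfolding leb by (rule AE_completion[OF pos])
  have "AE t in lborel. emeasure lebesgue
      {x \<in> attractor (ifs A t). infinite {w. w \<noteq> [] \<and> P t w x}} > 0"
    using pos
  proof eventually_elim
    fix t assume t: "0 < limsup (\<lambda>n. emeasure lborel (?V t n))"
    define L where "L = {x. \<exists>\<^sub>\<infinity>n. x \<in> ?V t n}"
    \<comment> \<open>Level 0 is discarded: its set need not be measurable, and one level does not matter.\<close>
    define U where "U n = (if n = 0 then {} else ?V t n)" for n
    have U: "U n \<in> sets lborel" for n
    proof (cases "n = 0")
      case False
      then have "0 < n" by simp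
      have "U n = ?V t n" unfolding U_def using False by (rule if_not_P)
      then show ?thesis using Vb[OF \<open>0 < n\<close>, of t] by (simp only: sets_lborel)
    qed (simp add: U_def)
    have UL: "{x. \<exists>\<^sub>\<infinity>n. x \<in> U n} = L"
    proof -
      have "(\<exists>\<^sub>\<infinity>n. x \<in> U n) \<longleftrightarrow> (\<exists>\<^sub>\<infinity>n. x \<in> ?V t n)" for x
      proof -
        have "n < k \<and> x \<in> U k \<longleftrightarrow> n < k \<and> x \<in> ?V t k" for n k
          by (cases k) (simp_all add: U_def)
        then show ?thesis unfolding INFM_nat by simp
      qed
      then show ?thesis by (simp add: L_def)
    qed
    have UB: "U n \<subseteq> cball 0 (2 * norm t + Q)" for n
    proof
      fix x assume "x \<in> U n"
      then obtain w where w: "w \<noteq> []" "P t w x" by (auto simp: U_def split: if_splits)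
      then have "norm (x - point A (w \<frown> \<tau> w) t) \<le> Q" using P FQ by fastforce
      then have "norm x \<le> norm (point A (w \<frown> \<tau> w) t) + Q"
        using norm_triangle_sub[of x "point A (w \<frown> \<tau> w) t"] by linarith
      then show "x \<in> cball 0 (2 * norm t + Q)"
        using norm_point[of "w \<frown> \<tau> w" t] by simp
    qed
    have "limsup (\<lambda>n. emeasure lborel (?V t n)) = limsup (\<lambda>n. emeasure lborel (U n))"
      by (rule Limsup_eq, rule eventually_mono[OF eventually_gt_at_top[of 0]]) (simp add: U_def)
    also have "\<dots> \<le> emeasure lborel L"
      unfolding UL[symmetric]
      using limsup_emeasure_le_infinitely_often[of U lborel "cball 0 (2 * norm t + Q)"] U UB
        emeasure_lborel_cball_finite[of "0 :: real ^ 'd" "2 * norm t + Q"] by simp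
    finally have posL: "0 < emeasure lborel L" using t by (rule order_less_le_trans[rotated])
    have Lb: "L \<in> sets borel"
    proof -
      have "L = (\<Inter>m. \<Union>n\<in>{m..}. U n)"
        unfolding UL[symmetric] by (auto simp: INFM_nat_le)
      also have "\<dots> \<in> sets borel" using U by auto
      finally show ?thesis .
    qed
    have "L \<subseteq> attractor (ifs A t)"
    proof
      fix x assume x: "x \<in> L"
      have "\<exists>\<^sub>\<infinity>n. \<exists>w. length w = n \<and> norm (T_word (ifs A t) w x) \<le> norm x + 2 * norm t + Q"
        unfolding INFM_nat
      proof
        fix k
        obtain n w where n: "n > k" "length w = n" "P t w x"
          using x unfolding L_def INFM_nat by blast
        then have "norm (T_word (ifs A t) w x) \<le> norm x + 2 * norm t + Q"
          by (intro PT) auto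
        then show "\<exists>n>k. \<exists>w. length w = n \<and> norm (T_word (ifs A t) w x) \<le> norm x + 2 * norm t + Q"
          using n by blast
      qed
      then show "x \<in> attractor (ifs A t)" by (rule mem_attractorI)
    qed
    then have "{x \<in> attractor (ifs A t). infinite {w. w \<noteq> [] \<and> P t w x}} = L"
      unfolding infinitely_many_words_iff L_def by auto
    then show "emeasure lebesgue {x \<in> attractor (ifs A t). infinite {w. w \<noteq> [] \<and> P t w x}} > 0"
      using posL Lb by simp
  qed
  then have "AE t in lebesgue. emeasure lebesgue
      {x \<in> attractor (ifs A t). infinite {w. w \<noteq> [] \<and> P t w x}} > 0"
    by (rule AE_completion)
  with limsup_pos show ?thesis by (rule conjI)
qed

end

section \<open>Shrinking targets and recurrence\<close>

context affine_contractions
begin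

text \<open>
  A word \<open>w\<close> moves \<open>x\<close> to \<open>point A (\<sigma> n) t + e\<close> iff \<open>x - point A (w \<frown> \<sigma> n) t\<close> is \<open>A\<^sub>w e\<close>.
\<close>

lemma
  fixes \<sigma> :: "nat \<Rightarrow> nat \<Rightarrow> 'i" and E :: "nat \<Rightarrow> (real ^ 'd) set"
  assumes v: "0 < v" and E: "\<And>n. n \<ge> 1 \<Longrightarrow> E n \<in> sets borel"
    and emE: "\<And>n. n \<ge> 1 \<Longrightarrow> emeasure lborel (E n) = ennreal (v / lam A ^ n)"
    and Q: "\<And>n. n \<ge> 1 \<Longrightarrow> E n \<subseteq> cball 0 Q"
  shows shrinking_targets_limsup:
    "AE t in lebesgue. limsup (\<lambda>n. emeasure lebesgue
       {x. \<exists>w. length w = n \<and> T_word (ifs A t) w x \<in> (+) (point A (\<sigma> n) t) ` E n}) > 0"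
    and shrinking_targets_infinite:
    "AE t in lebesgue. emeasure lebesgue {x \<in> attractor (ifs A t).
       infinite {w. w \<noteq> [] \<and> T_word (ifs A t) w x \<in> (+) (point A (\<sigma> (length w)) t) ` E (length w)}} > 0"
proof -
  define P where "P t w x \<longleftrightarrow> T_word (ifs A t) w x \<in> (+) (point A (\<sigma> (length w)) t) ` E (length w)" for t w x
  define F where "F w = (*v) (mat_word A w) ` E (length w)" for w
  define m where "m w = jac A w * (v / lam A ^ length w)" for w
  have len: "length w \<ge> 1" if "w \<noteq> []" for w :: "'i list"
    using that by (cases w) auto
  have hit_iff: "P t w x \<longleftrightarrow> x - point A (w \<frown> \<sigma> (length w)) t \<in> F w" for t w x
  proof -
    let ?z = "point A (\<sigma> (length w)) t"
    have "T_word (ifs A t) w x = ?z + e \<longleftrightarrow> x - point A (w \<frown> \<sigma> (length w)) t = mat_word A w *v e" for e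
      using S_word_diff[of A t w "?z + e" ?z] by (auto simp: T_word_iff point_conc algebra_simps)
    then show ?thesis by (auto simp: P_def F_def image_iff)
  qed
  have hit_bounded: "norm (T_word (ifs A t) w x) \<le> norm x + 2 * norm t + Q" if w: "w \<noteq> []" and hit: "P t w x" for t w x
  proof -
    obtain e where e: "e \<in> E (length w)" "T_word (ifs A t) w x = point A (\<sigma> (length w)) t + e"
      using hit by (auto simp: P_def)
    have "norm e \<le> Q" using e(1) Q[OF len[OF w]] by auto
    then show ?thesis
      unfolding e(2) using norm_point[of "\<sigma> (length w)" t] norm_triangle_ineq[of "point A (\<sigma> (length w)) t" e]
        norm_ge_zero[of x] by linarith
  qed
  have F_bounded: "F w \<subseteq> cball 0 Q" if "w \<noteq> []" for w
  proof
    fix y assume "y \<in> F w"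
    then obtain e where e: "e \<in> E (length w)" "y = mat_word A w *v e" by (auto simp: F_def)
    have "norm y \<le> \<rho> ^ length w * norm e" unfolding e(2) by (rule norm_mat_word)
    also have "\<dots> \<le> 1 * norm e"
      using \<rho> by (intro mult_right_mono power_le_one) auto
    finally show "y \<in> cball 0 Q" using e(1) Q[OF len[OF that]] by auto
  qed
  have F_borel: "F w \<in> sets borel" if "w \<noteq> []" for w
    unfolding F_def by (rule borel_linear_image[OF invertible_mat_word E[OF len[OF that]]])
  have F_measure: "emeasure lborel (F w) = ennreal (m w)" if "w \<noteq> []" for w
    unfolding F_def m_def emeasure_linear_image[OF invertible_mat_word E[OF len[OF that]]] emE[OF len[OF that]]
    by (rule ennreal_mult'[symmetric]) simp
  have m_bounds: "v * (jac A w / lam A ^ length w) \<le> m w" "m w \<le> v * (jac A w / lam A ^ length w)" for w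
    unfolding m_def by (simp_all only: times_divide_eq_right mult.commute[of v])
  have hits: "(AE t in lebesgue. limsup (\<lambda>n. emeasure lebesgue {x. \<exists>w. length w = n \<and> P t w x}) > 0)
    \<and> (AE t in lebesgue. emeasure lebesgue
      {x \<in> attractor (ifs A t). infinite {w. w \<noteq> [] \<and> P t w x}} > 0)"
  proof (rule word_targets_positive[of P "\<lambda>w. \<sigma> (length w)" F "Q" m "v" "v"])
    fix t x and w :: "'i list" assume w: "w \<noteq> []"
    show "P t w x \<longleftrightarrow> x - point A (w \<frown> \<sigma> (length w)) t \<in> F w" by (rule hit_iff)
    show "norm (T_word (ifs A t) w x) \<le> norm x + 2 * norm t + Q" if "P t w x" by (rule hit_bounded[OF w that])
    show "F w \<subseteq> cball 0 Q" by (rule F_bounded[OF w])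
    show "F w \<in> sets borel" by (rule F_borel[OF w])
    show "emeasure lborel (F w) = ennreal (m w)" by (rule F_measure[OF w])
    show "v * (jac A w / lam A ^ length w) \<le> m w" by (rule m_bounds(1))
    show "m w \<le> v * (jac A w / lam A ^ length w)" by (rule m_bounds(2))
  qed (rule v)
  have eq: "{x. \<exists>w. length w = n \<and> T_word (ifs A t) w x \<in> (+) (point A (\<sigma> n) t) ` E n}
      = {x. \<exists>w. length w = n \<and> P t w x}" for t n
    by (auto simp: P_def)
  show "AE t in lebesgue. limsup (\<lambda>n. emeasure lebesgue
       {x. \<exists>w. length w = n \<and> T_word (ifs A t) w x \<in> (+) (point A (\<sigma> n) t) ` E n}) > 0"
    unfolding eq by (rule hits[THEN conjunct1])
  show "AE t in lebesgue. emeasure lebesgue {x \<in> attractor (ifs A t).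
       infinite {w. w \<noteq> [] \<and> T_word (ifs A t) w x \<in> (+) (point A (\<sigma> (length w)) t) ` E (length w)}} > 0"
    using hits[THEN conjunct2] unfolding P_def .
qed

text \<open>
  With \<open>p\<close> the fixed point of \<open>S\<^sub>w\<close>, a word \<open>w\<close> moves \<open>x\<close> to \<open>x + e\<close> iff \<open>(1 - A\<^sub>w) (x - p) = A\<^sub>w e\<close>. As \<open>A\<^sub>w\<close> has
  norm at most \<open>1/2\<close>, the factor \<open>1 - A\<^sub>w\<close> and its inverse change lengths by a factor of at most 2, which changes volumes
  only by a bounded factor.
\<close>

lemma
  fixes E :: "nat \<Rightarrow> (real ^ 'd) set"
  assumes E: "\<And>n. n \<ge> 1 \<Longrightarrow> E n \<in> sets borel"
    and emE: "\<And>n. n \<ge> 1 \<Longrightarrow> emeasure lborel (E n) = ennreal (1 / lam A ^ n)"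
    and Q: "\<And>n. n \<ge> 1 \<Longrightarrow> E n \<subseteq> cball 0 Q"
  shows recurrence_limsup:
    "AE t in lebesgue. limsup (\<lambda>n. emeasure lebesgue
       {x. \<exists>w. length w = n \<and> T_word (ifs A t) w x \<in> (+) x ` E n}) > 0"
    and recurrence_infinite:
    "AE t in lebesgue. emeasure lebesgue {x \<in> attractor (ifs A t).
       infinite {w. w \<noteq> [] \<and> T_word (ifs A t) w x \<in> (+) x ` E (length w)}} > 0"
proof -
  define P where "P t w x \<longleftrightarrow> T_word (ifs A t) w x \<in> (+) x ` E (length w)" for t w x
  define N where "N w = mat 1 - mat_word A w" for w
  define F where "F w = (*v) (N w) -` ((*v) (mat_word A w) ` E (length w))" for w
  define m where "m w = 1 / \<bar>det (N w)\<bar> * (jac A w / lam A ^ length w)" for w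
  have len: "length w \<ge> 1" if "w \<noteq> []" for w :: "'i list"
    using that by (cases w) auto
  have Nx: "N w *v x = x - mat_word A w *v x" for w x
    by (simp add: N_def matrix_vector_mult_diff_rdistrib)
  have half: "norm (mat_word A w *v x) \<le> 1 / 2 * norm x" if "w \<noteq> []" for w x
  proof -
    have "\<rho> ^ length w \<le> \<rho> ^ 1"
      using len[OF that] \<rho> by (intro power_decreasing) auto
    then have "\<rho> ^ length w * norm x \<le> 1 / 2 * norm x"
      using \<rho> by (intro mult_right_mono) auto
    then show ?thesis using norm_mat_word[of w x] by linarith
  qed
  have Nlow: "1 / 2 * norm x \<le> norm (N w *v x)" if "w \<noteq> []" for w x
    unfolding Nx using half[OF that, of x] norm_triangle_ineq2[of x "mat_word A w *v x"] by linarith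
  have Nup: "norm (N w *v x) \<le> 2 * norm x" if "w \<noteq> []" for w x
    unfolding Nx using half[OF that, of x] norm_triangle_ineq4[of x "mat_word A w *v x"] norm_ge_zero[of x] by linarith
  have Ninv: "invertible (N w)" and Ndet: "(1 / 2) ^ CARD('d) \<le> \<bar>det (N w)\<bar>" "\<bar>det (N w)\<bar> \<le> 2 ^ CARD('d)"
    if "w \<noteq> []" for w
  proof -
    show inv: "invertible (N w)" and "(1 / 2) ^ CARD('d) \<le> \<bar>det (N w)\<bar>"
      using det_lower_bound[of "1 / 2" "N w"] Nlow[OF that] by auto
    show "\<bar>det (N w)\<bar> \<le> 2 ^ CARD('d)"
      using det_upper_bound[OF inv, of 2] Nup[OF that] by auto
  qed
  have Npos: "0 < \<bar>det (N w)\<bar>" if "w \<noteq> []" for w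
    using Ndet(1)[OF that] zero_less_power[of "1 / 2 :: real" "CARD('d)"] by linarith
  have hit_iff: "P t w x \<longleftrightarrow> x - point A (w \<frown> w\<^sup>\<omega>) t \<in> F w" if "w \<noteq> []" for t w x
  proof -
    let ?p = "point A (w \<frown> w\<^sup>\<omega>) t"
    have fixpoint: "?p = S_word (ifs A t) w ?p"
      using point_conc[of w "w\<^sup>\<omega>" t] iter_unroll[of w] that by simp
    have "T_word (ifs A t) w x = x + e \<longleftrightarrow> N w *v (x - ?p) = mat_word A w *v e" for e
    proof -
      have "T_word (ifs A t) w x = x + e \<longleftrightarrow> x - ?p = S_word (ifs A t) w (x + e) - S_word (ifs A t) w ?p"
        unfolding T_word_iff using fixpoint by auto
      also have "S_word (ifs A t) w (x + e) - S_word (ifs A t) w ?p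
          = mat_word A w *v (x - ?p) + mat_word A w *v e"
        unfolding S_word_diff matrix_vector_right_distrib[symmetric] by (simp add: algebra_simps)
      finally show ?thesis unfolding Nx by (auto simp: algebra_simps)
    qed
    then show ?thesis by (auto simp: P_def F_def image_iff)
  qed
  have hit_bounded: "norm (T_word (ifs A t) w x) \<le> norm x + 2 * norm t + \<bar>Q\<bar>" if w: "w \<noteq> []" and hit: "P t w x" for t w x
  proof -
    obtain e where e: "e \<in> E (length w)" "T_word (ifs A t) w x = x + e"
      using hit by (auto simp: P_def)
    have "norm e \<le> Q" using e(1) Q[OF len[OF w]] by auto
    then show ?thesis
      unfolding e(2) using norm_triangle_ineq[of x e] norm_ge_zero[of t] by linarith
  qed
  have F_bounded: "F w \<subseteq> cball 0 \<bar>Q\<bar>" if "w \<noteq> []" for w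
  proof
    fix y assume "y \<in> F w"
    then obtain e where e: "e \<in> E (length w)" "N w *v y = mat_word A w *v e" by (auto simp: F_def)
    have "norm e \<le> Q" using e(1) Q[OF len[OF that]] by auto
    then show "y \<in> cball 0 \<bar>Q\<bar>"
      using Nlow[OF that, of y] half[OF that, of e] e(2) by simp
  qed
  have im: "(*v) (mat_word A w) ` E (length w) \<in> sets borel" if "w \<noteq> []" for w
    by (rule borel_linear_image[OF invertible_mat_word E[OF len[OF that]]])
  have F_borel: "F w \<in> sets borel" if "w \<noteq> []" for w
    unfolding F_def by (rule borel_vimage_matrix[OF im[OF that]])
  have F_measure: "emeasure lborel (F w) = ennreal (m w)" if "w \<noteq> []" for w
  proof -
    let ?d = "\<bar>det (N w)\<bar>"
    have "ennreal ?d * emeasure lborel (F w) = ennreal (jac A w / lam A ^ length w)"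
      unfolding F_def emeasure_linear_vimage[OF Ninv[OF that] im[OF that]]
        emeasure_linear_image[OF invertible_mat_word E[OF len[OF that]]] emE[OF len[OF that]]
      by (subst ennreal_mult'[symmetric]) auto
    then have "ennreal (1 / ?d) * (ennreal ?d * emeasure lborel (F w))
        = ennreal (1 / ?d) * ennreal (jac A w / lam A ^ length w)" by simp
    moreover have "ennreal (1 / ?d) * ennreal ?d = 1"
      using Npos[OF that] by (simp add: ennreal_mult[symmetric])
    moreover have "ennreal (1 / ?d) * ennreal (jac A w / lam A ^ length w) = ennreal (m w)"
      unfolding m_def by (rule ennreal_mult'[symmetric]) simp
    ultimately show ?thesis by (simp add: mult.assoc[symmetric])
  qed
  have q0: "0 \<le> jac A w / lam A ^ length w" for w
    using lam_gt_1 by (intro divide_nonneg_nonneg) auto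
  have m_lower: "(1 / 2) ^ CARD('d) * (jac A w / lam A ^ length w) \<le> m w" if "w \<noteq> []" for w
  proof -
    have "(1 / 2) ^ CARD('d) \<le> 1 / \<bar>det (N w)\<bar>"
      using Ndet(2)[OF that] Npos[OF that] by (simp add: power_one_over field_simps)
    from mult_right_mono[OF this q0[of w]] show ?thesis unfolding m_def .
  qed
  have m_upper: "m w \<le> 2 ^ CARD('d) * (jac A w / lam A ^ length w)" if "w \<noteq> []" for w
  proof -
    have "1 / \<bar>det (N w)\<bar> \<le> 2 ^ CARD('d)"
      using Ndet(1)[OF that] Npos[OF that] by (simp add: power_one_over field_simps)
    from mult_right_mono[OF this q0[of w]] show ?thesis unfolding m_def .
  qed
  have c_pos: "0 < (1 / 2 :: real) ^ CARD('d)" by simp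
  have hits: "(AE t in lebesgue. limsup (\<lambda>n. emeasure lebesgue {x. \<exists>w. length w = n \<and> P t w x}) > 0)
    \<and> (AE t in lebesgue. emeasure lebesgue
      {x \<in> attractor (ifs A t). infinite {w. w \<noteq> [] \<and> P t w x}} > 0)"
  proof (rule word_targets_positive[of P "iter" F "\<bar>Q\<bar>" m "(1 / 2) ^ CARD('d)" "2 ^ CARD('d)"])
    fix t x and w :: "'i list" assume w: "w \<noteq> []"
    show "P t w x \<longleftrightarrow> x - point A (w \<frown> iter w) t \<in> F w" by (rule hit_iff[OF w])
    show "norm (T_word (ifs A t) w x) \<le> norm x + 2 * norm t + \<bar>Q\<bar>" if "P t w x" by (rule hit_bounded[OF w that])
    show "F w \<subseteq> cball 0 \<bar>Q\<bar>" by (rule F_bounded[OF w])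
    show "F w \<in> sets borel" by (rule F_borel[OF w])
    show "emeasure lborel (F w) = ennreal (m w)" by (rule F_measure[OF w])
    show "(1 / 2) ^ CARD('d) * (jac A w / lam A ^ length w) \<le> m w" by (rule m_lower[OF w])
    show "m w \<le> 2 ^ CARD('d) * (jac A w / lam A ^ length w)" by (rule m_upper[OF w])
  qed (rule c_pos)
  have eq: "{x. \<exists>w. length w = n \<and> T_word (ifs A t) w x \<in> (+) x ` E n}
      = {x. \<exists>w. length w = n \<and> P t w x}" for t n
    by (auto simp: P_def)
  show "AE t in lebesgue. limsup (\<lambda>n. emeasure lebesgue
       {x. \<exists>w. length w = n \<and> T_word (ifs A t) w x \<in> (+) x ` E n}) > 0"
    unfolding eq by (rule hits[THEN conjunct1])
  show "AE t in lebesgue. emeasure lebesgue {x \<in> attractor (ifs A t).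
       infinite {w. w \<noteq> [] \<and> T_word (ifs A t) w x \<in> (+) x ` E (length w)}} > 0"
    using hits[THEN conjunct2] unfolding P_def .
qed

end

section \<open>Full measure for differentiation regular attractors\<close>

context affine_contractions
begin

lemma emeasure_S_word_image:
  assumes Y: "Y \<in> sets borel"
  shows "S_word (ifs A t) w ` Y \<in> sets borel"
    and "emeasure lborel (S_word (ifs A t) w ` Y) = ennreal (jac A w) * emeasure lborel Y"
proof -
  define b where "b = S_word (ifs A t) w 0"
  have Sx: "S_word (ifs A t) w y = mat_word A w *v y + b" for y
    unfolding b_def using S_word_diff[of A t w y 0] by (simp add: diff_eq_eq)
  have im: "S_word (ifs A t) w ` Y = {x. x + - b \<in> (*v) (mat_word A w) ` Y}"
  proof -
    have "x = mat_word A w *v y + b \<longleftrightarrow> x + - b = mat_word A w *v y" for x y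
      by (simp only: add_uminus_conv_diff diff_eq_eq)
    then show ?thesis by (simp only: image_def Sx mem_Collect_eq)
  qed
  have [measurable]: "(*v) (mat_word A w) ` Y \<in> sets borel"
    by (rule borel_linear_image[OF invertible_mat_word Y])
  show "S_word (ifs A t) w ` Y \<in> sets borel" unfolding im by measurable
  show "emeasure lborel (S_word (ifs A t) w ` Y) = ennreal (jac A w) * emeasure lborel Y"
    unfolding im by (simp only: emeasure_lborel_shift[OF borel_linear_image[OF invertible_mat_word Y]]
        emeasure_linear_image[OF invertible_mat_word Y])
qed

text \<open>
  Suppose \<open>x\<close> is a density point of \<open>attractor - H\<close>. Small sets \<open>V j\<close> around \<open>x\<close> contain copies \<open>S\<^sub>w attractor\<close> that fill a
  proportion \<open>\<eta>\<close> of them. In such a copy, \<open>S\<^sub>w H\<close> has the same proportion as \<open>H\<close> has in the attractor, and it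
  consists of points of \<open>H\<close>. So the proportion of \<open>attractor - H\<close> in \<open>V j\<close> stays away from 1.
\<close>

lemma full_measure_of_invariant:
  assumes reg: "differentiation_regular (ifs A t)"
    and H: "H \<in> sets borel" "H \<subseteq> attractor (ifs A t)" "0 < emeasure lborel H"
    and inv: "\<And>w. S_word (ifs A t) w ` H \<subseteq> H"
  shows "AE x in lebesgue. x \<in> attractor (ifs A t) \<longrightarrow> x \<in> H"
proof -
  let ?X = "attractor (ifs A t)"
  have Xb: "?X \<in> sets borel" by (intro borel_compact compact_attractor)
  have Xfin: "emeasure lborel ?X < \<infinity>"
    using emeasure_compact_finite[OF compact_attractor] .
  define a where "a = measure lborel ?X"
  define h where "h = measure lborel H"
  have emX: "emeasure lborel ?X = ennreal a"
    unfolding a_def using Xfin by (intro emeasure_eq_ennreal_measure) auto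
  have "emeasure lborel H \<le> emeasure lborel ?X" using H Xb by (intro emeasure_mono) auto
  then have emH: "emeasure lborel H = ennreal h"
    unfolding h_def using Xfin by (intro emeasure_eq_ennreal_measure) (auto simp: top_unique)
  have h: "0 < h" using H(3) emH by simp
  have a: "0 < a" using \<open>emeasure lborel H \<le> emeasure lborel ?X\<close> h unfolding emH emX by (simp add: a_def)
  obtain \<V> \<eta> where basis: "density_basis \<V> ?X" and \<eta>: "\<eta> > 0"
    and V: "\<And>x. x \<in> ?X \<Longrightarrow> \<exists>V :: nat \<Rightarrow> (real ^ 'd) set.
           (\<forall>j. V j \<in> \<V> \<and> x \<in> V j) \<and>
           filterlim V (shrinking \<V> x) sequentially \<and>
           (\<forall>j. \<exists>w. w \<noteq> [] \<and> S_word (ifs A t) w ` ?X \<subseteq> V j \<and>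
              emeasure lebesgue (S_word (ifs A t) w ` ?X) \<ge> ennreal \<eta> * emeasure lebesgue (V j))"
    using reg unfolding differentiation_regular_def by blast
  let ?B = "?X - H"
  have "?B \<in> sets borel" "?B \<subseteq> ?X" using Xb H by auto
  then have "AE x in lebesgue.
      ((\<lambda>V. measure lebesgue (V \<inter> ?B) / measure lebesgue V) \<longlongrightarrow> indicator ?B x) (shrinking \<V> x)"
    using basis unfolding density_basis_def by blast
  then show ?thesis
  proof eventually_elim
    fix x
    assume lim: "((\<lambda>V. measure lebesgue (V \<inter> ?B) / measure lebesgue V) \<longlongrightarrow> indicator ?B x) (shrinking \<V> x)"
    show "x \<in> ?X \<longrightarrow> x \<in> H"
    proof (rule impI, rule ccontr)
      assume x: "x \<in> ?X" "x \<notin> H"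
      obtain V :: "nat \<Rightarrow> (real ^ 'd) set" where V0: "\<forall>j. V j \<in> \<V> \<and> x \<in> V j"
        and Vlim: "filterlim V (shrinking \<V> x) sequentially"
        and Vw: "\<forall>j. \<exists>w. w \<noteq> [] \<and> S_word (ifs A t) w ` ?X \<subseteq> V j \<and>
              emeasure lebesgue (S_word (ifs A t) w ` ?X) \<ge> ennreal \<eta> * emeasure lebesgue (V j)"
        using V[OF x(1)] by (elim exE conjE)
      have Vj: "V j \<in> \<V>" "x \<in> V j" for j using V0 by auto
      have "((\<lambda>j. measure lebesgue (V j \<inter> ?B) / measure lebesgue (V j)) \<longlongrightarrow> indicator ?B x) sequentially"
        by (rule filterlim_compose[OF lim Vlim])
      then have lim1: "((\<lambda>j. measure lebesgue (V j \<inter> ?B) / measure lebesgue (V j)) \<longlongrightarrow> 1) sequentially"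
        using x by simp
      have "shrinking \<V> x \<le> principal {V \<in> \<V>. x \<in> V \<and> bounded V \<and> diameter (insert x V) < 1}"
        unfolding shrinking_def by (rule INF_lower) simp
      then have "\<forall>\<^sub>F V in shrinking \<V> x. bounded V"
        by (rule filter_leD) (auto simp: eventually_principal)
      then have bdd: "\<forall>\<^sub>F j in sequentially. bounded (V j)"
        using Vlim by (rule eventually_compose_filterlim)
      have "measure lebesgue (V j \<inter> ?B) / measure lebesgue (V j) \<le> 1 - \<eta> * h / a" if b: "bounded (V j)" for j
      proof -
        have op: "open (V j)" using basis Vj(1) by (auto simp: density_basis_def)
        have lm: "V j \<in> lmeasurable" using op b by (intro lmeasurable_open)
        let ?v = "measure lebesgue (V j)"
        have emV: "emeasure lebesgue (V j) = ennreal ?v" using lm by (simp add: emeasure_eq_measure2)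
        have vpos: "0 < ?v"
        proof -
          obtain e where e: "e > 0" "ball x e \<subseteq> V j" using op Vj(2) open_contains_ball by blast
          have "0 < measure lebesgue (ball x e)" using e(1) by (simp add: content_ball)
          also have "\<dots> \<le> ?v" using e(2) lm by (intro measure_mono_fmeasurable) auto
          finally show ?thesis .
        qed
        obtain w where w: "S_word (ifs A t) w ` ?X \<subseteq> V j"
          "ennreal \<eta> * emeasure lebesgue (V j) \<le> emeasure lebesgue (S_word (ifs A t) w ` ?X)"
          using Vw[rule_format, of j] by blast
        have "ennreal (\<eta> * ?v) \<le> ennreal (jac A w * a)"
          using w(2) emeasure_S_word_image[OF Xb, of t w] \<eta> a
          by (simp add: emV emX ennreal_mult)
        then have jac: "\<eta> * ?v \<le> jac A w * a"
          using a by (simp add: ennreal_le_iff)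
        let ?Y = "S_word (ifs A t) w ` H"
        have Yb: "?Y \<in> sets borel" by (rule emeasure_S_word_image[OF H(1)])
        have emY: "emeasure lborel ?Y = ennreal (jac A w * h)"
          using emeasure_S_word_image(2)[OF H(1), of t w] h by (simp add: emH ennreal_mult)
        have mY: "measure lebesgue ?Y = jac A w * h"
          using emY Yb h by (simp add: measure_def)
        have Ylm: "?Y \<in> lmeasurable"
          using emY Yb by (intro fmeasurableI) auto
        have sub: "V j \<inter> ?B \<subseteq> V j - ?Y" "?Y \<subseteq> V j"
          using inv[of w] w(1) H(2) by auto
        have "measure lebesgue (V j \<inter> ?B) \<le> measure lebesgue (V j - ?Y)"
          using sub lm Ylm Xb H(1) by (intro measure_mono_fmeasurable fmeasurable_Diff) auto
        also have "\<dots> = ?v - jac A w * h"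
          using lm Ylm sub mY by (subst measurable_measure_Diff) auto
        finally have le: "measure lebesgue (V j \<inter> ?B) \<le> ?v - jac A w * h" .
        have "\<eta> * h / a * ?v \<le> jac A w * h"
          using mult_right_mono[OF jac, of "h / a"] h a by (simp add: field_simps)
        with le have "measure lebesgue (V j \<inter> ?B) \<le> (1 - \<eta> * h / a) * ?v"
          by (simp add: left_diff_distrib)
        then show ?thesis using vpos by (simp add: pos_divide_le_eq)
      qed
      then have "\<forall>\<^sub>F j in sequentially. measure lebesgue (V j \<inter> ?B) / measure lebesgue (V j) \<le> 1 - \<eta> * h / a"
        using bdd by (auto elim: eventually_mono)
      then have "1 \<le> 1 - \<eta> * h / a"
        by (intro tendsto_upperbound[OF lim1]) auto
      moreover have "0 < \<eta> * h / a" using \<eta> h a by simp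
      ultimately show False by linarith
    qed
  qed
qed

lemma W_ball_mono:
  assumes "0 < C" "C \<le> D"
  shows "W_ball A t y C \<subseteq> W_ball A t y D"
proof -
  have "(C / lam A ^ n) powr (1 / real CARD('d)) \<le> (D / lam A ^ n) powr (1 / real CARD('d))" for n
    using assms lam_gt_1 by (intro powr_mono2 divide_right_mono) auto
  then have "{w. w \<noteq> [] \<and> T_word (ifs A t) w z \<in> cball y ((C / lam A ^ length w) powr (1 / real CARD('d)))}
      \<subseteq> {w. w \<noteq> [] \<and> T_word (ifs A t) w z \<in> cball y ((D / lam A ^ length w) powr (1 / real CARD('d)))}" for z
    by (auto intro: order_trans)
  then show ?thesis
    unfolding W_ball_def using infinite_super by blast
qed

lemma W_ball_borel: "W_ball A t y C \<in> sets borel"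
proof -
  let ?r = "\<lambda>n. (C / lam A ^ n) powr (1 / real CARD('d))"
  have img: "{z. T_word (ifs A t) w z \<in> cball y r} = S_word (ifs A t) w ` cball y r" for w r
  proof (intro set_eqI iffI)
    fix z assume "z \<in> {z. T_word (ifs A t) w z \<in> cball y r}"
    then have "S_word (ifs A t) w (T_word (ifs A t) w z) \<in> S_word (ifs A t) w ` cball y r" by blast
    then show "z \<in> S_word (ifs A t) w ` cball y r" by simp
  qed auto
  have "W_ball A t y C = attractor (ifs A t)
      \<inter> (\<Inter>m. \<Union>n\<in>{m..}. \<Union>w\<in>{w. length w = n}. {z. T_word (ifs A t) w z \<in> cball y (?r n)})"
    unfolding W_ball_def infinitely_many_words_iff INFM_nat_le by (auto 4 3)
  also have "\<dots> \<in> sets borel"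
  proof -
    have "(\<Union>w\<in>{w. length w = n}. S_word (ifs A t) w ` cball y r) \<in> sets borel" for n r
      by (intro sets.finite_UN finite_words emeasure_S_word_image(1)) simp
    then show ?thesis
      unfolding img
      by (intro sets.Int borel_compact[OF compact_attractor] sets.countable_INT'' sets.countable_UN') auto
  qed
  finally show ?thesis .
qed

text \<open>
  If \<open>u\<close> moves \<open>z\<close> into its ball, then \<open>w @ u\<close> moves \<open>S\<^sub>w z\<close> to the same point, and the radius prescribed for
  the longer word is the same once \<open>C\<close> is multiplied by \<open>\<lambda>\<^bsup>length w\<^esup>\<close>.
\<close>

lemma S_word_W_ball:
  "S_word (ifs A t) w ` W_ball A t y C \<subseteq> W_ball A t y (C * lam A ^ length w)"
proof
  fix x assume "x \<in> S_word (ifs A t) w ` W_ball A t y C"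
  then obtain z where z: "z \<in> attractor (ifs A t)" "x = S_word (ifs A t) w z"
    and inf: "infinite {u. u \<noteq> [] \<and> T_word (ifs A t) u z \<in> cball y ((C / lam A ^ length u) powr (1 / real CARD('d)))}"
      (is "infinite ?I")
    by (auto simp: W_ball_def)
  have "infinite ((@) w ` ?I)"
    using inf by (simp add: finite_image_iff inj_on_def)
  moreover have "C * lam A ^ length w / lam A ^ (length w + n) = C / lam A ^ n" for n
    using lam_gt_1 by (simp add: power_add)
  ultimately have "infinite {u. u \<noteq> [] \<and> T_word (ifs A t) u x
      \<in> cball y ((C * lam A ^ length w / lam A ^ length u) powr (1 / real CARD('d)))}"
    by (elim infinite_super[rotated]) (auto simp: T_word_append z(2))
  moreover have "x \<in> attractor (ifs A t)"
    unfolding z(2) by (intro S_word_invariant ifs_attractor_subset z)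
  ultimately show "x \<in> W_ball A t y (C * lam A ^ length w)"
    by (simp add: W_ball_def)
qed

text \<open>
  These are shrinking targets: the ball of level \<open>n\<close> has measure \<open>v / \<lambda>\<^sup>n\<close> with \<open>v\<close> the volume of the unit ball.
\<close>

lemma W_ball_positive:
  fixes \<sigma> :: "nat \<Rightarrow> 'i"
  shows "AE t in lebesgue. emeasure lebesgue (W_ball A t (point A \<sigma> t) 1) > 0"
proof -
  define r where "r n = (1 / lam A ^ n) powr (1 / real CARD('d))" for n
  define v where "v = unit_ball_vol (real CARD('d))"
  have v: "0 < v" by (simp add: v_def)
  have lam: "0 < lam A" using lam_gt_1 by simp
  have rd: "r n ^ CARD('d) = 1 / lam A ^ n" for n
    using lam by (simp add: r_def powr_power)
  have em: "emeasure lborel (cball 0 (r n) :: (real ^ 'd) set) = ennreal (v / lam A ^ n)" for n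
    by (subst emeasure_cball) (simp_all add: r_def[symmetric] rd v_def, simp add: r_def)
  have r1: "cball 0 (r n) \<subseteq> (cball 0 1 :: (real ^ 'd) set)" for n
  proof -
    have "r n \<le> 1 powr (1 / real CARD('d))"
      unfolding r_def using lam_gt_1 by (intro powr_mono2) (auto simp: field_simps)
    then show ?thesis by auto
  qed
  have ball: "(+) y ` cball 0 s = cball y s" for y :: "real ^ 'd" and s
    by (simp add: cball_translation[symmetric])
  have "AE t in lebesgue. emeasure lebesgue {x \<in> attractor (ifs A t).
      infinite {w. w \<noteq> [] \<and> T_word (ifs A t) w x \<in> (+) (point A \<sigma> t) ` cball 0 (r (length w))}} > 0"
    by (rule shrinking_targets_infinite[of v "\<lambda>n. cball 0 (r n)" 1 "\<lambda>_. \<sigma>"]) (rule v em r1 | simp)+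
  then show ?thesis
    unfolding ball W_ball_def r_def .
qed

lemma W_ball_full_measure:
  fixes \<sigma> :: "nat \<Rightarrow> 'i"
  assumes "AE t in lebesgue. differentiation_regular (ifs A t)"
  shows "AE t in lebesgue. AE x in lebesgue. x \<in> attractor (ifs A t) \<longrightarrow>
     x \<in> (\<Union>C\<in>{0<..}. W_ball A t (point A \<sigma> t) C)"
  using assms W_ball_positive[of \<sigma>]
proof eventually_elim
  fix t
  assume reg: "differentiation_regular (ifs A t)"
    and pos: "0 < emeasure lebesgue (W_ball A t (point A \<sigma> t) 1)"
  let ?W = "W_ball A t (point A \<sigma> t)"
  let ?H = "\<Union>C\<in>{0<..}. ?W C"
  have "?H = (\<Union>k. ?W (real (Suc k)))"
  proof (intro equalityI subsetI)
    fix x assume "x \<in> ?H"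
    then obtain C where C: "C > 0" "x \<in> ?W C" by auto
    obtain k where "C \<le> real k" using real_arch_simple by blast
    then have "x \<in> ?W (real (Suc k))" using C W_ball_mono[of C "real (Suc k)"] by auto
    then show "x \<in> (\<Union>k. ?W (real (Suc k)))" by blast
  qed force
  also have "\<dots> \<in> sets borel"
    by (intro sets.countable_UN) (auto simp: W_ball_borel)
  finally have Hb: "?H \<in> sets borel" .
  have "emeasure lebesgue (?W 1) \<le> emeasure lebesgue ?H"
    using Hb by (intro emeasure_mono UN_upper[of "1 :: real"]) auto
  then have Hpos: "0 < emeasure lborel ?H"
    using pos Hb by (simp add: W_ball_borel)
  have "S_word (ifs A t) w ` ?H \<subseteq> ?H" for w
  proof
    fix x assume "x \<in> S_word (ifs A t) w ` ?H"
    then obtain C where C: "C > 0" "x \<in> S_word (ifs A t) w ` ?W C" by blast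
    have "C * lam A ^ length w > 0" using C(1) lam_gt_1 by simp
    moreover have "x \<in> ?W (C * lam A ^ length w)"
      using C(2) S_word_W_ball[of t w] by (rule subsetD[rotated])
    ultimately show "x \<in> ?H" by (intro UN_I[of "C * lam A ^ length w"]) simp_all
  qed
  moreover have "?H \<subseteq> attractor (ifs A t)" by (auto simp: W_ball_def)
  ultimately show "AE x in lebesgue. x \<in> attractor (ifs A t) \<longrightarrow> x \<in> ?H"
    using full_measure_of_invariant[OF reg Hb _ Hpos] by blast
qed

end

section \<open>The three statements together\<close>

lemma admissible_targets:
  assumes "admissible A E"
  obtains Q where "\<And>n. n \<ge> 1 \<Longrightarrow> E n \<in> sets borel"
    "\<And>n. n \<ge> 1 \<Longrightarrow> emeasure lborel (E n) = ennreal (1 / lam A ^ n)"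
    "\<And>n. n \<ge> 1 \<Longrightarrow> E n \<subseteq> cball 0 Q"
proof -
  obtain Q where Q: "\<forall>n\<ge>1. E n \<subseteq> cube Q"
    using assms by (auto simp: admissible_def)
  have "bounded (cube Q :: (real ^ 'b) set)" by (simp add: cube_def bounded_cbox)
  then obtain R where "cube Q \<subseteq> (cball 0 R :: (real ^ 'b) set)"
    by (auto simp: bounded_iff subset_iff)
  moreover have "E n \<in> sets borel" "emeasure lborel (E n) = ennreal (1 / lam A ^ n)" if "n \<ge> 1" for n
  proof -
    show b: "E n \<in> sets borel" using assms that by (simp add: admissible_def)
    have "emeasure lebesgue (E n) = ennreal (1 / lam A ^ n)"
      using assms that unfolding admissible_def by blast
    then show "emeasure lborel (E n) = ennreal (1 / lam A ^ n)" using b by simp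
  qed
  ultimately show thesis using Q by (intro that[of R]) blast+
qed

theorem theorem2p3:
  fixes A :: "'i::finite \<Rightarrow> real ^ 'd ^ 'd"
  assumes "\<And>i. invertible (A i)"
    and "\<And>i. onorm (\<lambda>x. A i *v x) < 1 / 2"
    and "lam A > 1"
  shows
    "(\<forall>(\<omega> :: nat \<Rightarrow> nat \<Rightarrow> 'i) (E :: nat \<Rightarrow> (real ^ 'd) set). admissible A E \<longrightarrow>
        (AE t in lebesgue.
           limsup (\<lambda>n. emeasure lebesgue
             {x. \<exists>w. length w = n \<and> T_word (ifs A t) w x \<in> (+) (proj (ifs A t) (\<omega> n)) ` E n}) > 0) \<and>
        (AE t in lebesgue.
           emeasure lebesgue (W_set (ifs A t) (\<lambda>n. proj (ifs A t) (\<omega> n)) E) > 0)) \<and>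
     (\<forall>\<omega> :: nat \<Rightarrow> 'i.
        (AE t in lebesgue. differentiation_regular (ifs A t)) \<longrightarrow>
        (AE t in lebesgue. AE x in lebesgue.
           x \<in> attractor (ifs A t) \<longrightarrow> x \<in> (\<Union>C\<in>{0<..}. W_ball A t (proj (ifs A t) \<omega>) C))) \<and>
     (\<forall>E :: nat \<Rightarrow> (real ^ 'd) set. admissible A E \<longrightarrow>
        (AE t in lebesgue.
           limsup (\<lambda>n. emeasure lebesgue
             {x. \<exists>w. length w = n \<and> T_word (ifs A t) w x \<in> (+) x ` E n}) > 0) \<and>
        (AE t in lebesgue. emeasure lebesgue (R_set (ifs A t) E) > 0))"
proof -
  define \<rho> where "\<rho> = Max (range (\<lambda>i. onorm (\<lambda>x. A i *v x)))"
  have le: "onorm (\<lambda>x. A i *v x) \<le> \<rho>" for i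
    unfolding \<rho>_def by (intro Max_ge) auto
  have "\<rho> < 1 / 2"
    unfolding \<rho>_def using assms(2) by (subst Max_less_iff) auto
  moreover have "0 \<le> \<rho>"
    using le[of undefined] onorm_pos_le[OF matrix_vector_mul_bounded_linear[of "A undefined"]] by linarith
  moreover have "norm (A i *v x) \<le> \<rho> * norm x" for i x
    using onorm[OF matrix_vector_mul_bounded_linear[of "A i"], of x]
      mult_right_mono[OF le[of i] norm_ge_zero[of x]] by linarith
  ultimately interpret affine_contractions A \<rho>
    using assms by unfold_locales auto
  show ?thesis
  proof (intro conjI allI impI)
    fix \<omega> :: "nat \<Rightarrow> nat \<Rightarrow> 'i" and E :: "nat \<Rightarrow> (real ^ 'd) set"
    assume "admissible A E"
    then obtain Q where E: "\<And>n. n \<ge> 1 \<Longrightarrow> E n \<in> sets borel"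
      "\<And>n. n \<ge> 1 \<Longrightarrow> emeasure lborel (E n) = ennreal (1 / lam A ^ n)"
      "\<And>n. n \<ge> 1 \<Longrightarrow> E n \<subseteq> cball 0 Q"
      by (rule admissible_targets) blast
    show "AE t in lebesgue. limsup (\<lambda>n. emeasure lebesgue
        {x. \<exists>w. length w = n \<and> T_word (ifs A t) w x \<in> (+) (proj (ifs A t) (\<omega> n)) ` E n}) > 0"
      unfolding proj_eq_point
      by (rule shrinking_targets_limsup[of 1 E Q "\<lambda>n. \<omega> n \<circ> Suc"]) (rule zero_less_one, (erule E)+)
    show "AE t in lebesgue. emeasure lebesgue (W_set (ifs A t) (\<lambda>n. proj (ifs A t) (\<omega> n)) E) > 0"
      unfolding proj_eq_point W_set_def
      by (rule shrinking_targets_infinite[of 1 E Q "\<lambda>n. \<omega> n \<circ> Suc"]) (rule zero_less_one, (erule E)+)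
  next
    fix \<omega> :: "nat \<Rightarrow> 'i"
    assume "AE t in lebesgue. differentiation_regular (ifs A t)"
    then show "AE t in lebesgue. AE x in lebesgue.
        x \<in> attractor (ifs A t) \<longrightarrow> x \<in> (\<Union>C\<in>{0<..}. W_ball A t (proj (ifs A t) \<omega>) C)"
      unfolding proj_eq_point by (rule W_ball_full_measure)
  next
    fix E :: "nat \<Rightarrow> (real ^ 'd) set"
    assume "admissible A E"
    then obtain Q where E: "\<And>n. n \<ge> 1 \<Longrightarrow> E n \<in> sets borel"
      "\<And>n. n \<ge> 1 \<Longrightarrow> emeasure lborel (E n) = ennreal (1 / lam A ^ n)"
      "\<And>n. n \<ge> 1 \<Longrightarrow> E n \<subseteq> cball 0 Q"
      by (rule admissible_targets) blast
    show "AE t in lebesgue. limsup (\<lambda>n. emeasure lebesgue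
        {x. \<exists>w. length w = n \<and> T_word (ifs A t) w x \<in> (+) x ` E n}) > 0"
      using E by (rule recurrence_limsup)
    show "AE t in lebesgue. emeasure lebesgue (R_set (ifs A t) E) > 0"
      unfolding R_set_def using E by (rule recurrence_infinite)
  qed
qed

end
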